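(* Let $X$ be a scalar (real-valued) random variable with a probability density $p_X(\cdot)$ that is logarithmically concave. For a silence set $\mathscr{S}$ let $\mu_{\mathscr{S}}$ denote the median of $X$ conditioned on $X\in\mathscr{S}$. Then, given any probability value $\eta \in [0,1]$, one of the following holds: either (i) there is a unique interval $\mathscr{S}^* = [a^*_\eta,\, a^*_\eta + l^*_\eta]$ that has probability mass $\mathbb{P}[X\in\mathscr{S}^*]=\eta$ and that minimizes the conditional absolute error $$\mathbb{E}\left[\,\left|X - \mu_{\mathscr{S}}\right| \,\middle|\, X\in \mathscr{S}\right]$$ over all silence sets $\mathscr{S}$ having probability mass at least $\eta$; or (ii) there is a sliding family containing an infinity of optimal intervals, all of the same length: specifically, there are a unique positive length $l^*_\eta$, a unique lower bound $\underline{a}_\eta$ and a unique upper bound $\overline{a}_\eta$ such that, for every left end $a$ within these bounds, the interval $\mathscr{S}^*_a = [a,\, a+l^*_\eta]$ has probability mass $\eta$ and minimizes the conditional absolute error $$\mathbb{E}\left[\,\left|X - \mu_{\mathscr{S}}\right| \,\middle|\, X\in \mathscr{S}\right]$$ over all silence sets $\mathscr{S}$ having probability mass at least $\eta$.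
   Context: A silence set is a measurable set $\mathscr{S}\subseteq\mathbb{R}$; its probability mass is $\mathbb{P}[X\in\mathscr{S}]$. A probability density is logarithmically concave (log-concave) if its logarithm is a concave function over its support. For an interval $[a,b]$ the conditional median $\mu_{[a,b]}$ is the point satisfying $\int_a^{\mu_{[a,b]}} p_X(x)\,dx = \int_{\mu_{[a,b]}}^b p_X(x)\,dx = \tfrac12\,\mathbb{P}[X\in[a,b]]$; for a general silence set $\mathscr{S}$, $\mu_{\mathscr{S}}$ is a median of the conditional law of $X$ given $X\in\mathscr{S}$, equivalently a minimizer $y\in\mathbb{R}$ of $\mathbb{E}[|X-y| \mid X\in\mathscr{S}]$.
   Formalization: The interval in (i) is unique up to null sets of the law of X; if no bounded interval has mass η (η = 1, unbounded support), closed unbounded intervals are also allowed; the conditional error on a silence set of probability zero (relevant only for η = 0) is taken to be 0. *)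

theory Defs
  imports "HOL-Probability.Probability"
begin

definition log_concave_density :: "(real \<Rightarrow> real) \<Rightarrow> bool" where
  "log_concave_density p \<longleftrightarrow>
     (\<forall>x. 0 \<le> p x) \<and> concave_on {x. 0 < p x} (\<lambda>x. ln (p x))"

definition silence_mass :: "'a measure \<Rightarrow> ('a \<Rightarrow> real) \<Rightarrow> real set \<Rightarrow> real" where
  "silence_mass M X S = \<P>(\<omega> in M. X \<omega> \<in> S)"

definition is_cond_median :: "'a measure \<Rightarrow> ('a \<Rightarrow> real) \<Rightarrow> real set \<Rightarrow> real \<Rightarrow> bool" where
  "is_cond_median M X S m \<longleftrightarrow>
     1/2 \<le> \<P>(\<omega> in M. X \<omega> \<le> m \<bar> X \<omega> \<in> S) \<and>
     1/2 \<le> \<P>(\<omega> in M. m \<le> X \<omega> \<bar> X \<omega> \<in> S)"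

text \<open>The median may fail to be unique when \<open>S\<close> has gaps, but all medians give the same
  mean absolute deviation, so an arbitrary choice is harmless.\<close>

definition cond_median :: "'a measure \<Rightarrow> ('a \<Rightarrow> real) \<Rightarrow> real set \<Rightarrow> real" where
  "cond_median M X S = (SOME m. is_cond_median M X S m)"

text \<open>Here \<open>uniform_measure M A\<close> is the conditional probability measure of \<open>M\<close> given
  the event \<open>A\<close>. The nonnegative integral avoids any integrability side condition.
  For an event of probability zero, \<open>uniform_measure\<close> is the null measure, which fixes
  the convention that the conditional error on a null silence set is zero
  (see \<open>cond_abs_error_null\<close>).\<close>

definition cond_abs_error :: "'a measure \<Rightarrow> ('a \<Rightarrow> real) \<Rightarrow> real set \<Rightarrow> ennreal" where
  "cond_abs_error M X S =
     (\<integral>\<^sup>+ \<omega>. ennreal \<bar>X \<omega> - cond_median M X S\<bar>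
        \<partial>uniform_measure M {\<omega> \<in> space M. X \<omega> \<in> S})"

lemma cond_abs_error_null:
  assumes "prob_space M" "X \<in> borel_measurable M" "S \<in> sets borel" "silence_mass M X S = 0"
  shows "cond_abs_error M X S = 0"
proof -
  interpret prob_space M by fact
  let ?A = "{\<omega> \<in> space M. X \<omega> \<in> S}"
  have A: "?A \<in> sets M"
    using assms(2,3) by measurable
  have "emeasure M ?A = 0"
    using assms(4) by (simp add: silence_mass_def emeasure_eq_measure)
  then have "AE \<omega> in M. \<omega> \<notin> ?A"
    using A by (simp add: AE_iff_measurable[OF A])
  then show ?thesis
    unfolding cond_abs_error_def uniform_measure_def
    using A assms(2) by (subst nn_integral_density) (auto simp: nn_integral_0_iff_AE)
qed

definition optimal_silence_set ::
    "'a measure \<Rightarrow> ('a \<Rightarrow> real) \<Rightarrow> real \<Rightarrow> real set \<Rightarrow> bool" where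
  "optimal_silence_set M X \<eta> S \<longleftrightarrow>
     S \<in> sets borel \<and> \<eta> \<le> silence_mass M X S \<and>
     (\<forall>T \<in> sets borel. \<eta> \<le> silence_mass M X T \<longrightarrow> cond_abs_error M X S \<le> cond_abs_error M X T)"

text \<open>Intervals are of the form \<open>{a..a + l}\<close>. Only if no such interval has mass \<open>\<eta>\<close>
  (that is, \<open>\<eta> = 1\<close> and the density has unbounded support) are infinite endpoints allowed.\<close>

definition candidate_interval ::
    "'a measure \<Rightarrow> ('a \<Rightarrow> real) \<Rightarrow> real \<Rightarrow> real set \<Rightarrow> bool" where
  "candidate_interval M X \<eta> S \<longleftrightarrow>
     (\<exists>a l. 0 \<le> l \<and> S = {a..a + l}) \<or>
     (\<nexists>a l. 0 \<le> l \<and> silence_mass M X {a..a + l} = \<eta>) \<and> closed S \<and> is_interval S"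

definition optimal_interval ::
    "'a measure \<Rightarrow> ('a \<Rightarrow> real) \<Rightarrow> real \<Rightarrow> real set \<Rightarrow> bool" where
  "optimal_interval M X \<eta> S \<longleftrightarrow>
     candidate_interval M X \<eta> S \<and> silence_mass M X S = \<eta> \<and> optimal_silence_set M X \<eta> S"

text \<open>Silence sets are identified when they differ by a null set of the law of \<open>X\<close>. Without
  this, an optimal interval that reaches the boundary of the support of the density could be
  prolonged outside the support, and would never be literally unique.\<close>

definition same_silence_set ::
    "'a measure \<Rightarrow> ('a \<Rightarrow> real) \<Rightarrow> real set \<Rightarrow> real set \<Rightarrow> bool" where
  "same_silence_set M X S T \<longleftrightarrow> (AE \<omega> in M. X \<omega> \<in> S \<longleftrightarrow> X \<omega> \<in> T)"

definition unique_optimal_interval :: "'a measure \<Rightarrow> ('a \<Rightarrow> real) \<Rightarrow> real \<Rightarrow> bool" where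
  "unique_optimal_interval M X \<eta> \<longleftrightarrow>
     (\<exists>S. optimal_interval M X \<eta> S \<and>
          (\<forall>T. optimal_interval M X \<eta> T \<longrightarrow> same_silence_set M X T S))"

text \<open>The bounds \<open>lo\<close> and \<open>hi\<close> can only be unique if they delimit the full range of left
  ends, hence the equivalence.\<close>

definition sliding_family ::
    "'a measure \<Rightarrow> ('a \<Rightarrow> real) \<Rightarrow> real \<Rightarrow> real \<Rightarrow> real \<Rightarrow> real \<Rightarrow> bool" where
  "sliding_family M X \<eta> l lo hi \<longleftrightarrow>
     0 < l \<and> lo < hi \<and>
     (\<forall>a. optimal_interval M X \<eta> {a..a + l} \<longleftrightarrow> lo \<le> a \<and> a \<le> hi)"

end

theory Submission
  imports Defs
begin

text \<open>Put \<open>h = \<eta> / 2\<close>, let \<open>F\<close> be the distribution function of \<open>X\<close> and \<open>Q\<close> its inverse. For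
\<open>0 < \<eta> < 1\<close> an interval of mass \<open>\<eta>\<close> is, up to a null set, \<open>{Q (t - h)..Q (t + h)}\<close>, where \<open>t\<close> is the level
of its median \<open>Q t\<close>. With \<open>P\<close> an antiderivative of \<open>Q\<close>, its error is \<open>W t / \<eta>\<close>
(\<open>cond_abs_error_window\<close>), where \<open>W t = P (t + h) + P (t - h) - 2 * P t\<close>, and the derivative of \<open>W\<close> is
\<open>D t = Q (t + h) + Q (t - h) - 2 * Q t\<close>.

Log-concavity enters through one fact: the density as a function of the level, \<open>p (Q t)\<close>, is concave
(\<open>density_supergradient\<close>). Hence the derivative of \<open>Q\<close>, which is its reciprocal, is convex, the
second difference that is the derivative of \<open>D\<close> is nonnegative (\<open>second_difference_nonneg\<close>), and \<open>W\<close> is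
convex. A minimiser of \<open>W\<close> exists (\<open>minimiser_exists\<close>): either \<open>D\<close> has a zero, or \<open>D\<close> has
constant sign, and then the support is bounded on the side to which \<open>W\<close> decreases, so that the extreme
window is a bounded interval.

An arbitrary silence set \<open>T\<close> of mass at least \<open>\<eta>\<close> cannot beat the best window. Comparing
\<open>\<bar>x - m\<bar>\<close>, for the median \<open>m\<close> of \<open>T\<close>, with the distance to two points \<open>a \<le> m \<le> b\<close> bounds the error of
\<open>T\<close> from below by a quantity that does not involve \<open>T\<close> (\<open>cond_abs_error_dual_bound\<close>). If \<open>a\<close> and \<open>b\<close>
are the end points of a window whose centre is close to the level of \<open>m\<close>, this bound is
almost a value of \<open>W\<close> (\<open>dual_value_near_minimum\<close>).

So the optimal intervals are the windows at minimisers of \<open>W\<close> (\<open>optimal_interval_iff\<close>). If there is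
one minimiser, they all agree up to a null set. If \<open>s < t\<close> are two minimisers, then \<open>D\<close> vanishes
between them, and equality in the convexity estimate forces \<open>p\<close> to equal its maximum \<open>c\<close> on the whole
interval from \<open>Q (s - h)\<close> to \<open>Q (t + h)\<close> (\<open>plateau_between_minimisers\<close>). Then windows at minimisers have
length \<open>\<eta> / c\<close>, and an interval of this length is optimal if and only if it lies between the infimum
and the supremum of the plateau \<open>{x. p x = c}\<close>. These are the members of the sliding family.

For \<open>\<eta> = 0\<close> and \<open>\<eta> = 1\<close> any two competitors of mass \<open>\<eta>\<close> differ by a null set only.\<close>

section \<open>Log-concave functions\<close>

lemma log_concave_chord:
  assumes lc: "log_concave_density p" and pos: "0 < p x" "0 < p y" and l: "0 \<le> l" "l \<le> 1"
  shows "0 < p ((1 - l) * x + l * y)"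
    and "(1 - l) * ln (p x) + l * ln (p y) \<le> ln (p ((1 - l) * x + l * y))"
proof -
  have conc: "concave_on {x. 0 < p x} (\<lambda>x. ln (p x))"
    using lc by (simp add: log_concave_density_def)
  have "convex {x. 0 < p x}"
    using conc by (rule concave_on_imp_convex)
  then show "0 < p ((1 - l) * x + l * y)"
    using pos l by (auto simp: convex_alt)
  show "(1 - l) * ln (p x) + l * ln (p y) \<le> ln (p ((1 - l) * x + l * y))"
    using concave_onD[OF conc l, of x y] pos by simp
qed

lemma between_as_combination:
  fixes x z y :: real
  assumes "x \<le> z" "z \<le> y"
  obtains l where "0 \<le> l" "l \<le> 1" "z = (1 - l) * x + l * y"
proof (cases "x = y")
  case True
  then show ?thesis using assms that[of 0] by auto
next
  case False
  then have "x < y" using assms by auto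
  have "(z - x) / (y - x) * (y - x) = z - x" using \<open>x < y\<close> by simp
  then have "z = (1 - (z - x) / (y - x)) * x + (z - x) / (y - x) * y"
    by (simp only: left_diff_distrib right_diff_distrib)
  then show ?thesis
    by (intro that[of "(z - x) / (y - x)"]) (use assms \<open>x < y\<close> in auto)
qed

lemma log_concave_min_le:
  assumes lc: "log_concave_density p" and pos: "0 < p x" "0 < p y" and z: "x \<le> z" "z \<le> y"
  shows "min (p x) (p y) \<le> p z"
proof -
  obtain l where l: "0 \<le> l" "l \<le> 1" "z = (1 - l) * x + l * y"
    using between_as_combination[OF z] .
  note c = log_concave_chord[OF lc pos l(1,2), folded l(3)]
  have "ln (min (p x) (p y)) = (1 - l) * ln (min (p x) (p y)) + l * ln (min (p x) (p y))"
    by (simp add: algebra_simps)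
  also have "\<dots> \<le> (1 - l) * ln (p x) + l * ln (p y)"
    using pos l by (intro add_mono mult_left_mono) auto
  also have "\<dots> \<le> ln (p z)" by (rule c(2))
  finally show ?thesis using c(1) pos by simp
qed

lemma log_concave_between_le:
  assumes lc: "log_concave_density p" and "p x = c" "p y = c" "0 < c" "x \<le> z" "z \<le> y"
  shows "c \<le> p z"
  using log_concave_min_le[OF lc, of x y z] assms by auto

text \<open>A concave function that is constant on an interval has its maximum there: a larger value at \<open>z\<close>
  would, by the chord inequality, lift the function inside the interval on the side facing \<open>z\<close>.\<close>

lemma log_concave_plateau_maximal:
  assumes lc: "log_concave_density p" and AB: "A < B" and c: "0 < c"
    and plateau: "\<And>x. A < x \<Longrightarrow> x < B \<Longrightarrow> p x = c"
  shows "p z \<le> c"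
proof (rule ccontr)
  assume "\<not> p z \<le> c"
  then have z: "c < p z" by simp
  \<comment> \<open>Two points of the plateau: the chord from \<open>z\<close> to the farther one passes over the nearer one.\<close>
  define x where "x = (2 * A + B) / 3"
  define y where "y = (A + 2 * B) / 3"
  have xy: "A < x" "x < y" "y < B" using AB by (auto simp: x_def y_def)
  have p: "p x = c" "p y = c" using plateau xy by auto
  have strict: "c < p w" if "p u = c" "0 < l" "l \<le> 1" "w = (1 - l) * u + l * z" for u w l
  proof -
    have "0 < p u" "0 < p z" using that z c by auto
    note ch = log_concave_chord[OF lc this, of l]
    have "ln c = (1 - l) * ln c + l * ln c" by (simp add: algebra_simps)
    also have "\<dots> < (1 - l) * ln (p u) + l * ln (p z)"
      using that z c by simp
    also have "\<dots> \<le> ln (p w)" using ch(2) that by simp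
    finally show ?thesis using ch(1) that c by simp
  qed
  consider "z \<le> A" | "A < z" "z < B" | "B \<le> z" by linarith
  then show False
  proof cases
    case 1
    obtain l where "0 \<le> l" "l \<le> 1" "x = (1 - l) * z + l * y"
      using between_as_combination[of z x y] 1 xy by auto
    moreover have "l \<noteq> 1" using calculation xy by auto
    ultimately have "c < p x"
      by (intro strict[OF p(2), of "1 - l"]) auto
    then show ?thesis using p by simp
  next
    case 2 then show ?thesis using plateau z by auto
  next
    case 3
    obtain l where "0 \<le> l" "l \<le> 1" "y = (1 - l) * x + l * z"
      using between_as_combination[of x y z] 3 xy by auto
    moreover have "l \<noteq> 0" using calculation xy by auto
    ultimately have "c < p y"
      by (intro strict[OF p(1), of l]) auto
    then show ?thesis using p by simp
  qed
qed

text \<open>The two hypotheses say how \<open>p z * exp (- k * z)\<close> compares with its values at the end points; they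
  hold when \<open>ln p\<close> is concave and \<open>k\<close> is a supergradient at \<open>x\<close>. Integrating the lower bound gives the
  claim for \<open>k > 0\<close>, integrating the upper bound gives it for \<open>k < 0\<close>. This replaces the
  argument \<open>p' = (ln p)' * p \<le> k * p\<close>, which would need \<open>p\<close> to be differentiable.\<close>

lemma increment_le_of_exp_bounds:
  fixes p F :: "real \<Rightarrow> real"
  assumes xy: "x \<le> y"
    and der: "\<And>z. x \<le> z \<Longrightarrow> z \<le> y \<Longrightarrow> (F has_real_derivative p z) (at z)"
    and lower: "\<And>z. x \<le> z \<Longrightarrow> z \<le> y \<Longrightarrow> p y * exp (k * (z - y)) \<le> p z"
    and upper: "\<And>z. x \<le> z \<Longrightarrow> z \<le> y \<Longrightarrow> p z \<le> p x * exp (k * (z - x))"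
  shows "p y - p x \<le> k * (F y - F x)"
proof -
  consider "k = 0" | "0 < k" | "k < 0" by linarith
  then show ?thesis
  proof cases
    case 1
    then show ?thesis using upper[of y] xy by simp
  next
    case 2
    have "k * F x - p y * exp (k * (x - y)) \<le> k * F y - p y * exp (k * (y - y))"
    proof (rule DERIV_nonneg_imp_nondecreasing[OF xy])
      fix z assume z: "x \<le> z" "z \<le> y"
      have "((\<lambda>z. k * F z - p y * exp (k * (z - y))) has_real_derivative
          k * p z - p y * (exp (k * (z - y)) * k)) (at z)"
        by (auto intro!: derivative_eq_intros der[OF z])
      moreover have "0 \<le> k * p z - p y * (exp (k * (z - y)) * k)"
        using mult_left_mono[OF lower[OF z], of k] 2 by (simp add: mult_ac)
      ultimately show "\<exists>d. ((\<lambda>z. k * F z - p y * exp (k * (z - y))) has_real_derivative d) (at z) \<and> 0 \<le> d"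
        by blast
    qed
    moreover have "p y * exp (k * (x - y)) \<le> p x" using lower[of x] xy by simp
    ultimately show ?thesis by (simp add: algebra_simps)
  next
    case 3
    have "k * F x - p x * exp (k * (x - x)) \<le> k * F y - p x * exp (k * (y - x))"
    proof (rule DERIV_nonneg_imp_nondecreasing[OF xy])
      fix z assume z: "x \<le> z" "z \<le> y"
      have "((\<lambda>z. k * F z - p x * exp (k * (z - x))) has_real_derivative
          k * p z - p x * (exp (k * (z - x)) * k)) (at z)"
        by (auto intro!: derivative_eq_intros der[OF z])
      moreover have "0 \<le> k * p z - p x * (exp (k * (z - x)) * k)"
        using mult_left_mono_neg[OF upper[OF z], of k] 3 by (simp add: mult_ac)
      ultimately show "\<exists>d. ((\<lambda>z. k * F z - p x * exp (k * (z - x))) has_real_derivative d) (at z) \<and> 0 \<le> d"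
        by blast
    qed
    moreover have "p y \<le> p x * exp (k * (y - x))" using upper[of y] xy by simp
    ultimately show ?thesis by (simp add: algebra_simps)
  qed
qed

text \<open>Convexity of the reciprocal, in the form needed for the reciprocal of a concave function: \<open>c\<close> is the
  value in the middle, \<open>d\<close> the increment of a tangent, and \<open>a\<close> and \<open>b\<close> lie below the tangent. Equality
  forces the tangent to be horizontal and to be attained on both sides.\<close>

lemma reciprocal_midpoint:
  fixes a b c d :: real
  assumes pos: "0 < a" "0 < b" "0 < c" and le: "a \<le> c + d" "b \<le> c - d"
  shows "2 * (1 / c) \<le> 1 / a + 1 / b"
    and "1 / a + 1 / b = 2 * (1 / c) \<Longrightarrow> d = 0 \<and> a = c \<and> b = c"
proof -
  have cd: "0 < c + d" "0 < c - d" using assms by linarith+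
  have 1: "1 / (c + d) \<le> 1 / a" "1 / (c - d) \<le> 1 / b"
    using assms cd by (auto intro!: divide_left_mono)
  define q where "q = (c + d) * (c - d)"
  have q: "0 < q" using cd by (simp add: q_def)
  have "1 / (c + d) = c * (c - d) / (c * q)" "1 / (c - d) = c * (c + d) / (c * q)" "2 * (1 / c) = 2 * q / (c * q)"
    using cd pos by (simp_all add: q_def)
  then have "1 / (c + d) + 1 / (c - d) - 2 * (1 / c) = (c * (c - d) + c * (c + d) - 2 * q) / (c * q)"
    by (simp only: add_divide_distrib diff_divide_distrib)
  also have "c * (c - d) + c * (c + d) - 2 * q = 2 * d\<^sup>2"
    by (simp add: q_def power2_eq_square algebra_simps)
  finally have "1 / (c + d) + 1 / (c - d) - 2 * (1 / c) = 2 * d\<^sup>2 / (c * ((c + d) * (c - d)))"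
    by (simp add: q_def)
  then have 2: "1 / (c + d) + 1 / (c - d) = 2 * (1 / c) + 2 * d\<^sup>2 / (c * ((c + d) * (c - d)))"
    by simp
  have den: "0 < c * ((c + d) * (c - d))" using cd pos by simp
  then have 3: "0 \<le> 2 * d\<^sup>2 / (c * ((c + d) * (c - d)))" by simp
  show "2 * (1 / c) \<le> 1 / a + 1 / b" using 1 2 3 by linarith
  assume eq: "1 / a + 1 / b = 2 * (1 / c)"
  then have "2 * d\<^sup>2 / (c * ((c + d) * (c - d))) = 0" using 1 2 3 by linarith
  then have d: "d = 0" using den by auto
  have "1 / c \<le> 1 / a" "1 / c \<le> 1 / b" using 1 d by simp_all
  then have "1 / a = 1 / c" "1 / b = 1 / c" using eq by linarith+
  then show "d = 0 \<and> a = c \<and> b = c" using d pos by simp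
qed

section \<open>The law of a log-concave density\<close>

lemma (in finite_borel_measure) cdf_attains:
  assumes no_atom: "\<And>x. measure M {x} = 0" and u: "0 < u" "u < measure M (space M)"
  obtains x where "cdf M x = u"
proof -
  have "eventually (\<lambda>x. cdf M x < u) at_bot"
    using order_tendstoD(2)[OF cdf_lim_at_bot u(1)] .
  then obtain a where a: "\<And>x. x \<le> a \<Longrightarrow> cdf M x < u" by (auto simp: eventually_at_bot_linorder)
  have "eventually (\<lambda>x. u < cdf M x) at_top"
    using order_tendstoD(1)[OF cdf_lim_at_top u(2)] .
  then obtain b where b: "\<And>x. b \<le> x \<Longrightarrow> u < cdf M x" by (auto simp: eventually_at_top_linorder)
  have "a \<le> b" using a[of a] b[of a] by (cases "a \<le> b") auto
  moreover have "isCont (cdf M) x" for x using no_atom by (simp add: isCont_cdf)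
  ultimately have "\<exists>x. a \<le> x \<and> x \<le> b \<and> cdf M x = u"
    using a[of a] b[of b] by (intro IVT) auto
  then show ?thesis using that by blast
qed

locale log_concave_law =
  fixes p :: "real \<Rightarrow> real"
  assumes lc: "log_concave_density p"
    and p_meas [measurable]: "p \<in> borel_measurable borel"
    and prob: "prob_space (density lborel (\<lambda>x. ennreal (p x)))"
begin

definition N :: "real measure" where
  "N = density lborel (\<lambda>x. ennreal (p x))"

definition F :: "real \<Rightarrow> real" where
  "F = cdf N"

text \<open>The interior of the support. Defined through levels it is open by continuity of \<open>F\<close>, and it does not
  depend on the values of \<open>p\<close> on null sets.\<close>

definition U :: "real set" where
  "U = {x. 0 < F x \<and> F x < 1}"

sublocale N: real_distribution N
proof -
  interpret prob_space N using prob by (simp add: N_def)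
  show "real_distribution N" by standard (simp add: N_def)
qed

lemma p_nonneg [simp]: "0 \<le> p x"
  using lc by (simp add: log_concave_density_def)

lemma no_atom [simp]: "measure N {x} = 0" "emeasure N {x} = 0"
proof -
  have "AE y in lborel. y \<in> {x} \<longrightarrow> ennreal (p y) \<le> 0"
    using AE_lborel_singleton[of x] by eventually_elim simp
  then have "{x} \<in> null_sets N"
    unfolding N_def by (subst null_sets_density_iff) auto
  then show "emeasure N {x} = 0" by auto
  then show "measure N {x} = 0" by (simp add: measure_def)
qed

lemma F_mono: "x \<le> y \<Longrightarrow> F x \<le> F y"
  unfolding F_def by (rule N.cdf_nondecreasing)

lemma F_bounds [simp]: "0 \<le> F x" "F x \<le> 1"
  by (simp_all add: F_def N.cdf_nonneg N.cdf_bounded_prob)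

lemma isCont_F: "isCont F x"
  by (simp add: F_def N.isCont_cdf)

lemma continuous_F: "continuous_on A F"
  using isCont_F by (simp add: continuous_at_imp_continuous_on)

lemma measure_Iic: "measure N {..x} = F x"
  by (simp add: F_def cdf_def)

lemma measure_Iio: "measure N {..<x} = F x"
proof -
  have "{..x} = {..<x} \<union> {x}" by auto
  then have "F x = measure N {..<x} + measure N {x}"
    by (simp only: measure_Iic[symmetric], intro N.finite_measure_Union) auto
  then show ?thesis by simp
qed

lemma measure_Icc:
  assumes "a \<le> b"
  shows "measure N {a..b} = F b - F a"
proof -
  have "{..b} = {..<a} \<union> {a..b}" using assms by auto
  then have "F b = measure N {..<a} + measure N {a..b}"
    by (simp only: measure_Iic[symmetric], intro N.finite_measure_Union) auto
  then show ?thesis by (simp add: measure_Iio)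
qed

lemma measure_Int_Ici:
  assumes "S \<in> sets borel"
  shows "measure N (S \<inter> {m..}) = measure N S - measure N (S \<inter> {..m})"
    and "measure N (S \<inter> {..<m}) = measure N (S \<inter> {..m})"
proof -
  have "measure N (S \<inter> {..<m} \<union> S \<inter> {m..}) = measure N (S \<inter> {..<m}) + measure N (S \<inter> {m..})"
    using assms by (intro N.finite_measure_Union) auto
  also have "S \<inter> {..<m} \<union> S \<inter> {m..} = S" by auto
  finally have 1: "measure N S = measure N (S \<inter> {..<m}) + measure N (S \<inter> {m..})" .
  have "measure N (S \<inter> {m}) \<le> measure N {m}" by (intro N.finite_measure_mono) auto
  then have 2: "measure N (S \<inter> {m}) = 0" using measure_nonneg[of N "S \<inter> {m}"] by simp
  have "measure N (S \<inter> {..<m} \<union> S \<inter> {m}) = measure N (S \<inter> {..<m}) + measure N (S \<inter> {m})"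
    using assms by (intro N.finite_measure_Union) auto
  also have "S \<inter> {..<m} \<union> S \<inter> {m} = S \<inter> {..m}" by auto
  finally show "measure N (S \<inter> {..<m}) = measure N (S \<inter> {..m})" using 2 by simp
  then show "measure N (S \<inter> {m..}) = measure N S - measure N (S \<inter> {..m})" using 1 by simp
qed

lemma F_attains:
  assumes "0 < u" "u < 1"
  obtains x where "x \<in> U" "F x = u"
proof -
  obtain x where "cdf N x = u"
    using N.cdf_attains[of u] assms N.prob_space by auto
  then show ?thesis using assms that by (auto simp: F_def U_def)
qed

lemma open_U: "open U"
proof -
  have "U = F -` {0<..<1}" by (auto simp: U_def)
  then show ?thesis using continuous_F[of UNIV]
    by (simp add: continuous_on_open_vimage)
qed

lemma between_U: "x \<in> U \<Longrightarrow> y \<in> U \<Longrightarrow> x \<le> z \<Longrightarrow> z \<le> y \<Longrightarrow> z \<in> U"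
  using F_mono[of x z] F_mono[of z y] by (auto simp: U_def)

lemma convex_U: "convex U"
  unfolding is_interval_convex_1[symmetric] is_interval_1 using between_U by blast

lemma p_pos_of_mass:
  assumes [measurable]: "A \<in> sets borel" and "0 < measure N A"
  obtains x where "x \<in> A" "0 < p x"
proof -
  have "\<exists>x\<in>A. 0 < p x"
  proof (rule ccontr)
    assume "\<not> (\<exists>x\<in>A. 0 < p x)"
    then have "p x = 0" if "x \<in> A" for x
      using that p_nonneg[of x] by (metis less_eq_real_def)
    then have "emeasure N A = (\<integral>\<^sup>+x. 0 \<partial>lborel)"
      unfolding N_def by (subst emeasure_density) (auto simp: indicator_def intro!: nn_integral_0_iff_AE[THEN iffD2] AE_I2)
    then show False using assms by (simp add: measure_def)
  qed
  then show ?thesis using that by blast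
qed

text \<open>There is mass, hence a point of positive density, on both sides of \<open>x\<close>.\<close>

lemma p_pos_U:
  assumes "x \<in> U"
  shows "0 < p x"
proof -
  have "0 < measure N {..<x}" using assms by (simp add: U_def measure_Iio)
  then obtain y where y: "y < x" "0 < p y" using p_pos_of_mass[of "{..<x}"] by auto
  have "{x<..} = space N - {..x}" by auto
  then have "measure N {x<..} = 1 - F x"
    using N.prob_compl[of "{..x}"] by (simp add: measure_Iic)
  then have "0 < measure N {x<..}" using assms by (simp add: U_def)
  then obtain z where z: "x < z" "0 < p z" using p_pos_of_mass[of "{x<..}"] by auto
  have "0 < min (p y) (p z)" using y z by simp
  also have "\<dots> \<le> p x" using log_concave_min_le[OF lc, of y z x] y z by simp
  finally show ?thesis .
qed

lemma concave_ln_p: "concave_on U (\<lambda>x. ln (p x))"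
proof -
  have "convex_on {x. 0 < p x} (\<lambda>x. - ln (p x))"
    using lc by (simp add: log_concave_density_def concave_on_def)
  then show ?thesis
    unfolding concave_on_def by (rule convex_on_subset) (use p_pos_U convex_U in auto)
qed

lemma isCont_p:
  assumes "x \<in> U"
  shows "isCont p x"
proof -
  have "continuous_on U (\<lambda>x. - ln (p x))"
    using concave_ln_p[unfolded concave_on_def] by (rule convex_on_continuous[OF open_U])
  then have "continuous_on U (\<lambda>x. exp (- (- ln (p x))))"
    by (rule continuous_on_exp[OF continuous_on_minus])
  then have "continuous_on U p"
    by (rule continuous_on_eq) (simp add: p_pos_U)
  then show ?thesis using assms open_U by (simp add: continuous_on_eq_continuous_at)
qed

text \<open>On the open set \<open>U\<close> the density is continuous, so there \<open>F\<close> is differentiable in the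
  classical sense.\<close>

lemma DERIV_F:
  assumes "x \<in> U"
  shows "(F has_real_derivative p x) (at x)"
proof -
  obtain e where e: "0 < e" "ball x e \<subseteq> U" using open_U assms by (auto simp: open_contains_ball)
  define a where "a = x - e / 2"
  define b where "b = x + e / 2"
  have ab: "a < x" "x < b" "{a..b} \<subseteq> U"
    using e by (auto simp: a_def b_def dist_real_def intro!: e(2)[THEN subsetD])
  have cont: "continuous_on {a..b} p"
    using ab isCont_p by (auto intro!: continuous_at_imp_continuous_on)
  have F_eq: "F y = F a + integral {a..y} p" if y: "y \<in> {a..b}" for y
  proof -
    have "continuous_on {a..y} p" using cont y by (auto intro: continuous_on_subset)
    then have "(p has_integral integral {a..y} p) {a..y}"
      by (intro integrable_integral integrable_continuous_real)
    then have "emeasure N {a..y} = integral {a..y} p"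
      unfolding N_def using nn_integral_has_integral_lebesgue[of "{a..y}" p]
      by (subst emeasure_density)
         (auto simp: ennreal_indicator[symmetric] ennreal_mult'[symmetric] mult.commute)
    moreover have "0 \<le> integral {a..y} p" by (intro Henstock_Kurzweil_Integration.integral_nonneg
          integrable_continuous_real \<open>continuous_on {a..y} p\<close>) auto
    ultimately have "measure N {a..y} = integral {a..y} p" by (simp add: measure_def)
    then show ?thesis using measure_Icc[of a y] y by simp
  qed
  have "((\<lambda>y. F a + integral {a..y} p) has_real_derivative p x) (at x within {a..b})"
    using integral_has_real_derivative[OF cont, of x] ab by (auto intro!: derivative_eq_intros)
  then have "(F has_real_derivative p x) (at x within {a..b})"
  proof (rule has_field_derivative_transform_within)
    show "x \<in> {a..b}" using ab by simp
    show "F a + integral {a..y} p = F y" if "y \<in> {a..b}" for y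
      using F_eq[OF that] by simp
  qed (rule zero_less_one)
  then show ?thesis using ab by (simp add: at_within_Icc_at)
qed

text \<open>Substituting \<open>y = Q v\<close> and \<open>x = Q u\<close>, this says that \<open>u \<mapsto> p (Q u)\<close> has a supergradient
  at every level, so it is concave. The supergradient is the one of \<open>ln p\<close> at \<open>x\<close>.\<close>

lemma density_supergradient:
  assumes "x \<in> U"
  obtains k where "\<And>y. y \<in> U \<Longrightarrow> p y \<le> p x + k * (F y - F x)"
proof -
  have cvx: "convex_on U (\<lambda>x. - ln (p x))" by (rule concave_ln_p[unfolded concave_on_def])
  define k where "k = - Inf ((\<lambda>t. (- ln (p x) - - ln (p t)) / (x - t)) ` ({x<..} \<inter> U))"
  have k: "ln (p y) \<le> ln (p x) + k * (y - x)" if "y \<in> U" for y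
    using convex_le_Inf_differential[OF cvx, of x y] assms that
    unfolding k_def interior_open[OF open_U] by linarith
  \<comment> \<open>By concavity of \<open>ln p\<close>, \<open>p z * exp (- k * z)\<close> decreases as \<open>z\<close> moves away from \<open>x\<close>.\<close>
  have upper: "p z \<le> p x * exp (k * (z - x))" if "z \<in> U" for z
  proof -
    have "p z = exp (ln (p z))" using p_pos_U that by simp
    also have "\<dots> \<le> exp (ln (p x) + k * (z - x))" using k that by simp
    also have "\<dots> = p x * exp (k * (z - x))" using p_pos_U assms by (simp add: exp_add)
    finally show ?thesis .
  qed
  have lower: "p y * exp (k * (z - y)) \<le> p z"
    if y: "y \<in> U" and z: "z = (1 - l) * x + l * y" and l: "0 \<le> l" "l \<le> 1" for y z l
  proof -
    have pos: "0 < p x" "0 < p y" using p_pos_U assms y by auto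
    note ch = log_concave_chord[OF lc pos l, folded z]
    have "(1 - l) * ln (p y) \<le> (1 - l) * (ln (p x) + k * (y - x))"
      using k[OF y] l by (intro mult_left_mono) auto
    also have "\<dots> = (1 - l) * ln (p x) + k * ((1 - l) * (y - x))" by (simp add: algebra_simps)
    also have "(1 - l) * (y - x) = y - z" unfolding z by (simp add: algebra_simps)
    finally have "ln (p y) - l * ln (p y) \<le> (1 - l) * ln (p x) + k * (y - z)"
      by (simp add: left_diff_distrib)
    then have "ln (p y) \<le> ln (p z) + k * (y - z)" using ch(2) by linarith
    moreover have "k * (z - y) = - (k * (y - z))" by (simp add: right_diff_distrib)
    ultimately have "ln (p y) + k * (z - y) \<le> ln (p z)" by linarith
    then have "exp (ln (p y) + k * (z - y)) \<le> exp (ln (p z))" by simp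
    then show ?thesis using pos ch(1) by (simp add: exp_add)
  qed
  have "p y \<le> p x + k * (F y - F x)" if y: "y \<in> U" for y
  proof (cases "x \<le> y")
    case True
    have "p y - p x \<le> k * (F y - F x)"
    proof (rule increment_le_of_exp_bounds[OF True])
      fix z assume z: "x \<le> z" "z \<le> y"
      then have "z \<in> U" using between_U assms y by blast
      obtain l where l: "0 \<le> l" "l \<le> 1" "z = (1 - l) * x + l * y"
        using between_as_combination[OF z] .
      show "(F has_real_derivative p z) (at z)" "p z \<le> p x * exp (k * (z - x))"
        by (rule DERIV_F[OF \<open>z \<in> U\<close>] upper[OF \<open>z \<in> U\<close>])+
      show "p y * exp (k * (z - y)) \<le> p z" by (rule lower[OF y l(3,1,2)])
    qed
    then show ?thesis by simp
  next
    case False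
    \<comment> \<open>The case \<open>y < x\<close> is the other one for the reflected density, with \<open>- k\<close> for \<open>k\<close>.\<close>
    then have "- x \<le> - y" by simp
    then have "p (- (- y)) - p (- (- x)) \<le> (- k) * ((- F (- (- y))) - (- F (- (- x))))"
    proof (rule increment_le_of_exp_bounds)
      fix z assume "- x \<le> z" "z \<le> - y"
      then have z: "y \<le> - z" "- z \<le> x" by auto
      then have zU: "- z \<in> U" using between_U assms y by blast
      have "((\<lambda>z. - F (- z)) has_real_derivative - (- p (- z))) (at z)"
        using DERIV_F[OF zU] by (intro DERIV_minus) (simp only: DERIV_mirror[symmetric])
      then show "((\<lambda>z. - F (- z)) has_real_derivative p (- z)) (at z)" by simp
      show "p (- z) \<le> p (- (- x)) * exp (- k * (z - - x))"
      proof -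
        have "- k * (z - - x) = k * (- z - x)" by (simp add: algebra_simps)
        then show ?thesis using upper[OF zU] by simp
      qed
      obtain l where l: "0 \<le> l" "l \<le> 1" "- z = (1 - l) * y + l * x"
        using between_as_combination[OF z] .
      have "p y * exp (k * (- z - y)) \<le> p (- z)"
        by (rule lower[OF y, of _ "1 - l"]) (use l in auto)
      moreover have "- k * (z - - y) = k * (- z - y)" by (simp add: algebra_simps)
      ultimately show "p (- (- y)) * exp (- k * (z - - y)) \<le> p (- z)" by simp
    qed
    then show ?thesis by (simp add: algebra_simps)
  qed
  then show ?thesis using that by blast
qed

section \<open>Plateaus of the density\<close>

lemma measure_plateau:
  assumes "a \<le> b" "0 \<le> c" and plateau: "\<And>x. a < x \<Longrightarrow> x < b \<Longrightarrow> p x = c"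
  shows "F b - F a = c * (b - a)"
proof -
  have "emeasure N {a..b} = (\<integral>\<^sup>+x. ennreal (p x) * indicator {a..b} x \<partial>lborel)"
    unfolding N_def by (subst emeasure_density) auto
  also have "\<dots> = (\<integral>\<^sup>+x. ennreal c * indicator {a..b} x \<partial>lborel)"
  proof (rule nn_integral_cong_AE)
    show "AE x in lborel. ennreal (p x) * indicator {a..b} x = ennreal c * indicator {a..b} x"
      using AE_lborel_singleton[of a] AE_lborel_singleton[of b]
      by eventually_elim (use plateau in \<open>auto simp: indicator_def\<close>)
  qed
  also have "\<dots> = ennreal (c * (b - a))"
    using assms by (simp add: nn_integral_cmult_indicator ennreal_mult)
  finally have "measure N {a..b} = c * (b - a)"
    using assms by (simp add: measure_def)
  then show ?thesis using measure_Icc[OF assms(1)] by simp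
qed

text \<open>If the mass of an interval is as large as the bound \<open>p \<le> c\<close> permits, then \<open>p = c\<close> almost everywhere on it,
  in particular on a dense subset, and log-concavity fills the gaps.\<close>

lemma plateau_of_full_mass:
  assumes ab: "a \<le> b" and c: "0 < c" and le: "\<And>x. p x \<le> c" and mass: "F b - F a = c * (b - a)"
    and x: "a < x" "x < b"
  shows "p x = c"
proof -
  have "ennreal (c * (b - a)) = emeasure N {a..b}"
    using measure_Icc[OF ab] mass by (simp add: N.emeasure_eq_measure)
  also have "\<dots> = (\<integral>\<^sup>+x. ennreal (p x) * indicator {a..b} x \<partial>lborel)"
    unfolding N_def by (subst emeasure_density) auto
  finally have I: "(\<integral>\<^sup>+x. ennreal (p x) * indicator {a..b} x \<partial>lborel) = ennreal (c * (b - a))" ..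
  have "ennreal (c * (b - a)) + 0 = (\<integral>\<^sup>+x. ennreal c * indicator {a..b} x \<partial>lborel)"
    using ab c by (simp add: nn_integral_cmult_indicator ennreal_mult)
  also have "\<dots> = (\<integral>\<^sup>+x. ennreal (p x) * indicator {a..b} x +
      ennreal (c - p x) * indicator {a..b} x \<partial>lborel)"
    by (intro nn_integral_cong) (use le in \<open>auto simp: indicator_def ennreal_plus[symmetric] simp del: ennreal_plus\<close>)
  also have "\<dots> = ennreal (c * (b - a)) + (\<integral>\<^sup>+x. ennreal (c - p x) * indicator {a..b} x \<partial>lborel)"
    using I by (subst nn_integral_add) auto
  finally have "(\<integral>\<^sup>+x. ennreal (c - p x) * indicator {a..b} x \<partial>lborel) = 0"
    unfolding ennreal_add_left_cancel by simp
  then have "AE x in lborel. ennreal (c - p x) * indicator {a..b} x = 0"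
    by (subst (asm) nn_integral_0_iff_AE) auto
  then have ae: "AE x in lborel. x \<in> {a..b} \<longrightarrow> p x = c"
    by eventually_elim (use le in \<open>auto simp: indicator_def ennreal_eq_0_iff intro: antisym\<close>)
  have dense: "\<exists>w. u < w \<and> w < v \<and> p w = c" if "u < v" "a \<le> u" "v \<le> b" for u v
  proof (rule ccontr)
    assume contra: "\<not> ?thesis"
    have "AE w in lborel. w \<notin> {u<..<v}"
      using ae by eventually_elim (use contra that in auto)
    then have "{u<..<v} \<in> null_sets lborel"
      by (subst AE_iff_null_sets) auto
    then have "emeasure lborel {u<..<v} = 0" by auto
    then show False using that by simp
  qed
  obtain u where u: "a < u" "u < x" "p u = c" using dense[of a x] x by auto
  obtain v where v: "x < v" "v < b" "p v = c" using dense[of x b] x by auto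
  have "c \<le> p x" using log_concave_between_le[OF lc u(3) v(3) c] u v by simp
  then show ?thesis using le[of x] by simp
qed

text \<open>The set where the density equals its maximum is convex by log-concavity, and bounded since an
  interval inside it of length \<open>l\<close> has mass \<open>c * l \<le> 1\<close>.\<close>

lemma maximal_plateau:
  assumes c: "0 < c" "\<And>x. p x \<le> c" and w: "p w = c"
  shows "\<exists>lo hi. (\<forall>x. p x = c \<longrightarrow> lo \<le> x \<and> x \<le> hi) \<and> (\<forall>x. lo < x \<and> x < hi \<longrightarrow> p x = c)"
proof -
  define E where "E = {x. p x = c}"
  have between: "p z = c" if "p x = c" "p y = c" "x \<le> z" "z \<le> y" for x y z
    using log_concave_between_le[OF lc that(1,2) c(1) that(3,4)] c(2)[of z] by simp
  have len: "y - x \<le> 1 / c" if "p x = c" "p y = c" "x \<le> y" for x y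
  proof -
    have "F y - F x = c * (y - x)"
      using that c by (intro measure_plateau between[OF that(1,2)]) simp_all
    then have "c * (y - x) \<le> 1" using F_bounds(2)[of y] F_bounds(1)[of x] by linarith
    then show ?thesis using c by (simp add: pos_le_divide_eq mult.commute)
  qed
  have bound: "w - 1 / c \<le> x" "x \<le> w + 1 / c" if "x \<in> E" for x
  proof -
    have x: "p x = c" using that by (simp add: E_def)
    have "0 < 1 / c" using c by simp
    then show "w - 1 / c \<le> x" using len[OF x w] by (cases "x \<le> w") linarith+
    show "x \<le> w + 1 / c" using len[OF w x] \<open>0 < 1 / c\<close> by (cases "w \<le> x") linarith+
  qed
  have bdd: "bdd_below E" "bdd_above E" and ne: "E \<noteq> {}"
    using bdd_belowI[of E, OF bound(1)] bdd_aboveI[of E, OF bound(2)] w by (auto simp: E_def)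
  have "Inf E \<le> x \<and> x \<le> Sup E" if "p x = c" for x
    using cInf_lower[OF _ bdd(1), of x] cSup_upper[OF _ bdd(2), of x] that by (simp add: E_def)
  moreover have "p x = c" if x: "Inf E < x" "x < Sup E" for x
  proof -
    obtain y where "y \<in> E" "y < x" using cInf_less_iff[OF ne bdd(1)] x by blast
    moreover obtain z where "z \<in> E" "x < z" using less_cSup_iff[OF ne bdd(2)] x by blast
    ultimately show ?thesis using between[of y z x] by (simp add: E_def)
  qed
  ultimately show ?thesis by (intro exI[of _ "Inf E"] exI[of _ "Sup E"]) simp
qed

section \<open>The quantile function\<close>

text \<open>The closed support. In contrast to \<open>U\<close> it contains the end points of windows that reach to the boundary.\<close>

definition C :: "real set" where
  "C = closure U"

text \<open>The levels at which the quantile function is finite: all of \<open>{0<..<1}\<close>, and in addition 0 or 1 if the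
  support is bounded below or above.\<close>

definition J :: "real set" where
  "J = F ` C"

text \<open>The inverse of \<open>F\<close> on the closed support.\<close>

definition Q :: "real \<Rightarrow> real" where
  "Q = (SOME g. homeomorphism C J F g)"

lemma U_subset_C: "U \<subseteq> C"
  by (simp add: C_def closure_subset)

text \<open>Points of \<open>U\<close> approximate the ends, so \<open>z\<close> lies between two points of \<open>U\<close>.\<close>

lemma interior_C: "x \<in> C \<Longrightarrow> y \<in> C \<Longrightarrow> x < z \<Longrightarrow> z < y \<Longrightarrow> z \<in> U"
proof -
  assume xy: "x \<in> C" "y \<in> C" "x < z" "z < y"
  obtain x' where "x' \<in> U" "x' < z"
    using xy(1,3) unfolding C_def closure_approachable
    by (metis abs_less_iff diff_gt_0_iff_gt dist_real_def less_diff_eq add.commute diff_add_cancel add_less_cancel_right)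
  moreover obtain y' where "y' \<in> U" "z < y'"
  proof -
    obtain y' where "y' \<in> U" "dist y' y < y - z"
      using xy(2,4) unfolding C_def closure_approachable by (meson diff_gt_0_iff_gt)
    then show ?thesis using that[of y'] by (auto simp: dist_real_def)
  qed
  ultimately show "z \<in> U" using between_U[of x' y' z] by simp
qed

lemma F_strict_mono:
  assumes "x \<in> C" "y \<in> C" "x < y"
  shows "F x < F y"
proof (rule DERIV_pos_imp_increasing_open[OF assms(3)])
  fix z assume "x < z" "z < y"
  then have "z \<in> U" using interior_C assms by blast
  then show "\<exists>d. (F has_real_derivative d) (at z) \<and> 0 < d"
    using DERIV_F p_pos_U by blast
qed (rule continuous_F)

lemma F_inj: "x \<in> C \<Longrightarrow> y \<in> C \<Longrightarrow> F x = F y \<Longrightarrow> x = y"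
  using F_strict_mono[of x y] F_strict_mono[of y x] by linarith

lemma homeomorphism_Q: "homeomorphism C J F Q"
proof -
  have "convex C" unfolding C_def by (rule convex_closure[OF convex_U])
  then have "path_connected C" by (rule convex_imp_path_connected)
  moreover have "inj_on F C" using F_inj by (auto intro: inj_onI)
  ultimately have "\<exists>g. homeomorphism C J F g"
    by (intro homeomorphism_into_1d continuous_F) (simp_all add: J_def)
  then show ?thesis unfolding Q_def by (rule someI_ex)
qed

lemma F_Q [simp]: "u \<in> J \<Longrightarrow> F (Q u) = u"
  and Q_F [simp]: "x \<in> C \<Longrightarrow> Q (F x) = x"
  and Q_in_C [simp]: "u \<in> J \<Longrightarrow> Q u \<in> C"
  and continuous_Q: "continuous_on J Q"
  using homeomorphism_Q by (auto simp: homeomorphism_def)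

lemma F_in_J [simp]: "x \<in> C \<Longrightarrow> F x \<in> J"
  by (simp add: J_def)

lemma J_bounds: "u \<in> J \<Longrightarrow> 0 \<le> u" "u \<in> J \<Longrightarrow> u \<le> 1"
  by (auto simp: J_def)

lemma J_open_interval:
  assumes "0 < u" "u < 1"
  shows "u \<in> J"
proof -
  obtain x where "x \<in> U" "F x = u" using F_attains[OF assms] .
  then show ?thesis using U_subset_C by (auto simp: J_def)
qed

lemma J_between:
  assumes "u \<in> J" "v \<in> J" "u \<le> w" "w \<le> v"
  shows "w \<in> J"
  using assms J_bounds(1)[OF assms(1)] J_bounds(2)[OF assms(2)] J_open_interval[of w]
  by (cases "w = 0"; cases "w = 1") auto

lemma Q_strict_mono: "u \<in> J \<Longrightarrow> v \<in> J \<Longrightarrow> u < v \<Longrightarrow> Q u < Q v"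
  using F_mono[of "Q v" "Q u"] by (cases "Q u < Q v") auto

lemma Q_mono: "u \<in> J \<Longrightarrow> v \<in> J \<Longrightarrow> u \<le> v \<Longrightarrow> Q u \<le> Q v"
  using Q_strict_mono[of u v] by (cases "u = v") auto

lemma Q_in_U: "0 < u \<Longrightarrow> u < 1 \<Longrightarrow> Q u \<in> U"
  using J_open_interval[of u] by (simp add: U_def)

lemma p_Q_pos: "0 < u \<Longrightarrow> u < 1 \<Longrightarrow> 0 < p (Q u)"
  by (rule p_pos_U[OF Q_in_U])

lemma Q_eqI: "F x = u \<Longrightarrow> 0 < u \<Longrightarrow> u < 1 \<Longrightarrow> Q u = x"
  using Q_F[of x] U_subset_C by (auto simp: U_def)

text \<open>If \<open>F\<close> vanishes somewhere then \<open>U\<close> is bounded below, and its infimum is a point of the closed support that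
  has level 0.\<close>

lemma zero_in_J:
  assumes "F a = 0"
  shows "0 \<in> J"
proof -
  obtain x where x: "x \<in> U" using F_attains[of "1/2"] by auto
  have lb: "a \<le> y" if "y \<in> U" for y
    using that F_mono[of y a] assms by (cases "a \<le> y") (auto simp: U_def)
  have bdd: "bdd_below U" by (intro bdd_belowI[OF lb])
  have inC: "Inf U \<in> C" unfolding C_def using closure_contains_Inf[OF _ bdd] x by auto
  have "Inf U \<notin> U"
  proof
    assume "Inf U \<in> U"
    then obtain e where e: "0 < e" "ball (Inf U) e \<subseteq> U" using open_U by (auto simp: open_contains_ball)
    then have "Inf U - e / 2 \<in> U" by (auto simp: dist_real_def)
    then show False using cInf_lower[OF _ bdd, of "Inf U - e / 2"] e by simp
  qed
  moreover have "F (Inf U) < 1"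
    using F_mono[OF cInf_lower[OF x bdd]] x by (auto simp: U_def)
  ultimately have "F (Inf U) = 0" using F_bounds(1)[of "Inf U"] unfolding U_def mem_Collect_eq by linarith
  then show ?thesis using F_in_J[OF inC] by simp
qed

lemma one_in_J:
  assumes "F a = 1"
  shows "1 \<in> J"
proof -
  obtain x where x: "x \<in> U" using F_attains[of "1/2"] by auto
  have ub: "y \<le> a" if "y \<in> U" for y
    using that F_mono[of a y] assms by (cases "y \<le> a") (auto simp: U_def)
  have bdd: "bdd_above U" by (intro bdd_aboveI[OF ub])
  have inC: "Sup U \<in> C" unfolding C_def using closure_contains_Sup[OF _ bdd] x by auto
  have "Sup U \<notin> U"
  proof
    assume "Sup U \<in> U"
    then obtain e where e: "0 < e" "ball (Sup U) e \<subseteq> U" using open_U by (auto simp: open_contains_ball)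
    then have "Sup U + e / 2 \<in> U" by (auto simp: dist_real_def)
    then show False using cSup_upper[OF _ bdd, of "Sup U + e / 2"] e by simp
  qed
  moreover have "0 < F (Sup U)"
    using F_mono[OF cSup_upper[OF x bdd]] x by (auto simp: U_def)
  ultimately have "F (Sup U) = 1" using F_bounds(2)[of "Sup U"] unfolding U_def mem_Collect_eq by linarith
  then show ?thesis using F_in_J[OF inC] by simp
qed

lemma F_in_J_always: "F x \<in> J"
  using zero_in_J[of x] one_in_J[of x] J_open_interval[of "F x"] F_bounds[of x]
  by (cases "F x = 0"; cases "F x = 1") auto

text \<open>The criterion by which existence of a minimiser on the boundary is shown: if the quantiles
  stay bounded near level 0 then the quantile at level 0 is finite.\<close>

lemma zero_in_J_of_Q_bounded:
  assumes "\<And>u. 0 < u \<Longrightarrow> u < e \<Longrightarrow> b \<le> Q u" "0 < e" "e < 1"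
  shows "0 \<in> J"
proof -
  \<comment> \<open>The second condition makes the level of \<open>b'\<close> smaller than \<open>e\<close>.\<close>
  have "F b' = 0" if b': "b' < b" "b' < Q (e / 2)" for b'
  proof (rule ccontr)
    assume "F b' \<noteq> 0"
    then have pos: "0 < F b'" using F_bounds(1)[of b'] by linarith
    have "F b' \<le> F (Q (e / 2))" using b' by (intro F_mono) simp
    also have "\<dots> = e / 2" using assms by (intro F_Q J_open_interval) auto
    finally have lt: "F b' < e" using assms by simp
    have "b \<le> Q (F b')" by (rule assms(1)[OF pos lt])
    moreover have "Q (F b') = b'" using pos lt assms by (intro Q_eqI) auto
    ultimately show False using b' by simp
  qed
  from this[of "min b (Q (e / 2)) - 1"] show ?thesis
    by (intro zero_in_J[of "min b (Q (e / 2)) - 1"]) auto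
qed

lemma one_in_J_of_Q_bounded:
  assumes "\<And>u. e < u \<Longrightarrow> u < 1 \<Longrightarrow> Q u \<le> b" "0 < e" "e < 1"
  shows "1 \<in> J"
proof -
  have "F b' = 1" if b': "b < b'" "Q ((1 + e) / 2) < b'" for b'
  proof (rule ccontr)
    assume "F b' \<noteq> 1"
    then have pos: "F b' < 1" using F_bounds(2)[of b'] by linarith
    have "(1 + e) / 2 = F (Q ((1 + e) / 2))" using assms by (intro F_Q[symmetric] J_open_interval) auto
    also have "\<dots> \<le> F b'" using b' by (intro F_mono) simp
    finally have lt: "e < F b'" using assms by simp
    have "Q (F b') \<le> b" by (rule assms(1)[OF lt pos])
    moreover have "Q (F b') = b'" using pos lt assms by (intro Q_eqI) auto
    ultimately show False using b' by simp
  qed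
  from this[of "max b (Q ((1 + e) / 2)) + 1"] show ?thesis
    by (intro one_in_J[of "max b (Q ((1 + e) / 2)) + 1"]) auto
qed

lemma DERIV_Q:
  assumes "0 < u" "u < 1"
  shows "(Q has_real_derivative 1 / p (Q u)) (at u)"
proof -
  have "continuous_on {0<..<1} Q"
    using J_open_interval by (intro continuous_on_subset[OF continuous_Q]) auto
  then have "isCont Q u"
    using assms by (simp add: continuous_on_eq_continuous_at)
  then have "(Q has_real_derivative inverse (p (Q u))) (at u)"
    using assms J_open_interval p_Q_pos[OF assms]
    by (intro DERIV_inverse_function[where f = F and a = 0 and b = 1] DERIV_F Q_in_U) auto
  then show ?thesis by (simp add: inverse_eq_divide)
qed

section \<open>The Legendre transform of the integrated distribution function\<close>

text \<open>An arbitrary antiderivative of \<open>F\<close>: a constant cancels in the second differences of the Legendre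
  transform, and the normalisation that vanishes at \<open>- \<infinity>\<close> would presuppose a first moment.\<close>

definition K :: "real \<Rightarrow> real" where
  "K = (SOME G. \<forall>x. (G has_real_derivative F x) (at x))"

lemma DERIV_K: "(K has_real_derivative F x) (at x)"
proof -
  have "\<exists>G. \<forall>x. - \<infinity> < ereal x \<longrightarrow> ereal x < \<infinity> \<longrightarrow> (G has_vector_derivative F x) (at x)"
    by (rule einterval_antiderivative) (simp_all add: isCont_F)
  then have "\<exists>G. \<forall>x. (G has_real_derivative F x) (at x)"
    by (simp add: has_real_derivative_iff_has_vector_derivative)
  from someI_ex[OF this] show ?thesis unfolding K_def by blast
qed

lemma continuous_K: "continuous_on A K"
  using DERIV_K DERIV_isCont by (blast intro: continuous_at_imp_continuous_on)

lemma K_above_tangent: "K x + F x * (y - x) \<le> K y"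
proof -
  have "F x * (y - x) \<le> K y - K x"
  proof (cases x y rule: linorder_cases)
    case less
    obtain z where "x < z" "z < y" "K y - K x = (y - x) * F z"
      using MVT2[OF less, of K F] DERIV_K by auto
    then show ?thesis using F_mono[of x z] less by (simp add: mult.commute mult_left_mono)
  next
    case greater
    obtain z where z: "y < z" "z < x" "K x - K y = (x - y) * F z"
      using MVT2[OF greater, of K F] DERIV_K by auto
    then have "(x - y) * F z \<le> (x - y) * F x" using F_mono[of z x] greater by (intro mult_left_mono) auto
    then show ?thesis using z by (simp add: algebra_simps)
  qed simp
  then show ?thesis by simp
qed

text \<open>The Legendre transform of \<open>K\<close>, with the supremum evaluated at its maximum point \<open>Q u\<close>. It is an
  antiderivative of \<open>Q\<close>.\<close>

definition P :: "real \<Rightarrow> real" where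
  "P u = u * Q u - K (Q u)"

text \<open>The Fenchel inequality.\<close>

lemma P_ge:
  assumes "u \<in> J"
  shows "u * x - K x \<le> P u"
  using K_above_tangent[of "Q u" x] assms by (simp add: P_def algebra_simps)

lemma continuous_P: "continuous_on J P"
  unfolding P_def
  by (intro continuous_intros continuous_Q continuous_on_compose2[OF continuous_K continuous_Q]) auto

lemma DERIV_P:
  assumes "0 < u" "u < 1"
  shows "(P has_real_derivative Q u) (at u)"
proof -
  have "(P has_real_derivative (1 * Q u + 1 / p (Q u) * u) - F (Q u) * (1 / p (Q u))) (at u)"
    unfolding P_def
    by (intro DERIV_diff DERIV_mult DERIV_ident DERIV_Q assms DERIV_chain2[OF DERIV_K])
  then show ?thesis using J_open_interval[OF assms] by simp
qed

text \<open>Integration by parts. The end points are exempt from differentiability, as they may be boundary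
  points of the support, where \<open>p\<close> may jump.\<close>

lemma first_moment_has_integral:
  assumes "a \<in> C" "b \<in> C" "a \<le> b"
  shows "((\<lambda>x. (x - w) * p x) has_integral
    ((b - w) * F b - K b) - ((a - w) * F a - K a)) {a..b}"
proof (rule fundamental_theorem_of_calculus_interior[OF assms(3)])
  show "continuous_on {a..b} (\<lambda>x. (x - w) * F x - K x)"
    by (intro continuous_intros continuous_F continuous_K)
  fix x assume "x \<in> {a<..<b}"
  then have x: "x \<in> U" using interior_C[OF assms(1,2)] by simp
  have "((\<lambda>x. (x - w) * F x - K x) has_real_derivative (1 - 0) * F x + p x * (x - w) - F x) (at x)"
    by (intro DERIV_diff DERIV_mult DERIV_ident DERIV_const DERIV_F[OF x] DERIV_K)
  then show "((\<lambda>x. (x - w) * F x - K x) has_vector_derivative (x - w) * p x) (at x)"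
    by (simp add: has_real_derivative_iff_has_vector_derivative mult.commute)
qed

lemma nn_integral_N_Icc:
  assumes f: "f \<in> borel_measurable borel" "\<And>x. a \<le> x \<Longrightarrow> x \<le> b \<Longrightarrow> 0 \<le> f x"
    and I: "((\<lambda>x. f x * p x) has_integral I) {a..b}"
  shows "(\<integral>\<^sup>+x. ennreal (f x) * indicator {a..b} x \<partial>N) = ennreal I"
proof -
  have "(\<integral>\<^sup>+x. ennreal (f x) * indicator {a..b} x \<partial>N)
      = (\<integral>\<^sup>+x. ennreal (p x) * (ennreal (f x) * indicator {a..b} x) \<partial>lborel)"
    unfolding N_def using f by (subst nn_integral_density) auto
  also have "\<dots> = (\<integral>\<^sup>+x. ennreal (indicator {a..b} x * (f x * p x)) \<partial>lborel)"
    by (intro nn_integral_cong) (auto simp: indicator_def ennreal_mult'[symmetric] f(2) mult.commute)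
  also have "\<dots> = ennreal I"
    using I f(2) by (intro nn_integral_has_integral_lebesgue) auto
  finally show ?thesis .
qed

end

section \<open>Sliding a window of fixed mass\<close>

locale log_concave_window = log_concave_law +
  fixes h :: real
  assumes h: "0 < h" "h < 1/2"
begin

text \<open>The levels of the medians of bounded intervals of mass \<open>2 * h\<close>. The interval \<open>{h<..<1 - h}\<close> is contained in
  this set; whether its ends are depends on boundedness of the support.\<close>

definition centres :: "real set" where
  "centres = {t. t - h \<in> J \<and> t + h \<in> J}"

text \<open>The unnormalised error of the window centred at level \<open>t\<close>. The median itself drops out, as
  it has the same mass on both sides.\<close>

definition W :: "real \<Rightarrow> real" where
  "W t = P (t + h) + P (t - h) - 2 * P t"

text \<open>The derivative of \<open>W\<close>. It vanishes exactly if the median of the window is its midpoint.\<close>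

definition D :: "real \<Rightarrow> real" where
  "D t = Q (t + h) + Q (t - h) - 2 * Q t"

lemma centres_bounds: "t \<in> centres \<Longrightarrow> h \<le> t" "t \<in> centres \<Longrightarrow> t \<le> 1 - h"
  using J_bounds(1)[of "t - h"] J_bounds(2)[of "t + h"] by (auto simp: centres_def)

lemma centres_unit: "t \<in> centres \<Longrightarrow> 0 < t" "t \<in> centres \<Longrightarrow> t < 1"
  using centres_bounds[of t] h by auto

lemma centres_in_J: "t \<in> centres \<Longrightarrow> t \<in> J"
  using centres_unit J_open_interval by blast

lemma centres_between:
  assumes "s \<in> centres" "t \<in> centres" "s \<le> r" "r \<le> t"
  shows "r \<in> centres"
  using assms J_between[of "s - h" "t - h" "r - h"] J_between[of "s + h" "t + h" "r + h"]
  by (auto simp: centres_def)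

lemma Icc_centres: "s \<in> centres \<Longrightarrow> t \<in> centres \<Longrightarrow> {s..t} \<subseteq> centres"
  by (rule subsetI, rule centres_between[of s t]) simp_all

lemma centres_inner:
  assumes "s \<in> centres" "t \<in> centres" "s < r" "r < t"
  shows "h < r" "r < 1 - h"
  using centres_bounds(1)[OF assms(1)] centres_bounds(2)[OF assms(2)] assms(3,4) by simp_all

lemma centres_open: "h < t \<Longrightarrow> t < 1 - h \<Longrightarrow> t \<in> centres"
  using J_open_interval h by (auto simp: centres_def)

lemma continuous_shifts:
  assumes "continuous_on J f"
  shows "continuous_on centres (\<lambda>t. f (t + h))" "continuous_on centres (\<lambda>t. f (t - h))" "continuous_on centres f"
proof -
  show "continuous_on centres (\<lambda>t. f (t + h))"
    by (rule continuous_on_compose2[OF assms, of centres "\<lambda>t. t + h"])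
       (auto simp: centres_def intro!: continuous_on_add)
  show "continuous_on centres (\<lambda>t. f (t - h))"
    by (rule continuous_on_compose2[OF assms, of centres "\<lambda>t. t - h"])
       (auto simp: centres_def intro!: continuous_on_diff)
  show "continuous_on centres f"
    using centres_in_J by (intro continuous_on_subset[OF assms]) auto
qed

lemma continuous_D: "continuous_on centres D"
  unfolding D_def
  by (intro continuous_on_add continuous_on_diff continuous_on_mult continuous_on_const
      continuous_shifts continuous_Q)

lemma continuous_W: "continuous_on centres W"
  unfolding W_def
  by (intro continuous_on_add continuous_on_diff continuous_on_mult continuous_on_const
      continuous_shifts continuous_P)

lemma shifts: "((\<lambda>t. t + h) has_real_derivative 1) (at t)" "((\<lambda>t. t - h) has_real_derivative 1) (at t)"
  by (auto intro!: derivative_eq_intros)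

lemma DERIV_W:
  assumes "h < t" "t < 1 - h"
  shows "(W has_real_derivative D t) (at t)"
proof -
  have "(W has_real_derivative (Q (t + h) * 1 + Q (t - h) * 1 - 2 * Q t)) (at t)"
    unfolding W_def using assms h
    by (intro DERIV_add DERIV_diff DERIV_cmult DERIV_P DERIV_chain2[where f = P] shifts) auto
  then show ?thesis by (simp add: D_def)
qed

lemma DERIV_D:
  assumes "h < t" "t < 1 - h"
  shows "(D has_real_derivative 1 / p (Q (t + h)) + 1 / p (Q (t - h)) - 2 * (1 / p (Q t))) (at t)"
proof -
  have "(D has_real_derivative
      (1 / p (Q (t + h)) * 1 + 1 / p (Q (t - h)) * 1 - 2 * (1 / p (Q t)))) (at t)"
    unfolding D_def using assms h
    by (intro DERIV_add DERIV_diff DERIV_cmult DERIV_Q DERIV_chain2[where f = Q] shifts) auto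
  then show ?thesis by simp
qed

lemma W_nonneg: "t \<in> centres \<Longrightarrow> 0 \<le> W t"
  using P_ge[of "t + h" "Q t"] P_ge[of "t - h" "Q t"]
  by (simp add: W_def centres_def P_def algebra_simps)

text \<open>The supergradient inequality at the three levels of a window. The third inequality keeps the
  global information that a horizontal supergradient identifies a maximum.\<close>

lemma density_at_shifts:
  assumes t: "h < t" "t < 1 - h"
  obtains k where "p (Q (t + h)) \<le> p (Q t) + k * h" "p (Q (t - h)) \<le> p (Q t) - k * h"
    "\<And>y. y \<in> U \<Longrightarrow> p y \<le> p (Q t) + k * (F y - t)"
proof -
  have "Q t \<in> U" by (rule Q_in_U) (use t h in auto)
  then obtain k where k: "\<And>y. y \<in> U \<Longrightarrow> p y \<le> p (Q t) + k * (F y - F (Q t))"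
    using density_supergradient by blast
  have FQ: "F (Q t) = t" "F (Q (t + h)) = t + h" "F (Q (t - h)) = t - h"
    using t h by (auto intro!: F_Q J_open_interval)
  have "Q (t + h) \<in> U" "Q (t - h) \<in> U" using t h by (auto intro!: Q_in_U)
  from this[THEN k] show ?thesis using that[of k] k by (simp add: FQ)
qed

lemma second_difference_nonneg:
  assumes t: "h < t" "t < 1 - h"
  shows "0 \<le> 1 / p (Q (t + h)) + 1 / p (Q (t - h)) - 2 * (1 / p (Q t))"
proof -
  obtain k where "p (Q (t + h)) \<le> p (Q t) + k * h" "p (Q (t - h)) \<le> p (Q t) - k * h"
    using density_at_shifts[OF t] by blast
  from reciprocal_midpoint(1)[OF _ _ _ this] show ?thesis
    using t h by (auto simp: p_Q_pos)
qed

text \<open>In the case of equality the supergradient at level \<open>t\<close> is horizontal, so \<open>p (Q t)\<close> is the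
  maximum of the density, and the maximum is also attained at both ends of the window.\<close>

lemma second_difference_eq_0:
  assumes t: "h < t" "t < 1 - h"
    and zero: "1 / p (Q (t + h)) + 1 / p (Q (t - h)) - 2 * (1 / p (Q t)) = 0"
  shows "p (Q (t + h)) = p (Q t)" "p (Q (t - h)) = p (Q t)" "\<And>y. y \<in> U \<Longrightarrow> p y \<le> p (Q t)"
proof -
  obtain k where k: "p (Q (t + h)) \<le> p (Q t) + k * h" "p (Q (t - h)) \<le> p (Q t) - k * h"
    "\<And>y. y \<in> U \<Longrightarrow> p y \<le> p (Q t) + k * (F y - t)"
    using density_at_shifts[OF t] by blast
  have "k * h = 0 \<and> p (Q (t + h)) = p (Q t) \<and> p (Q (t - h)) = p (Q t)"
    using t h zero by (intro reciprocal_midpoint(2)[OF _ _ _ k(1,2)] p_Q_pos) auto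
  then have eqs: "k = 0" "p (Q (t + h)) = p (Q t)" "p (Q (t - h)) = p (Q t)" using h by simp_all
  show "p (Q (t + h)) = p (Q t)" "p (Q (t - h)) = p (Q t)" by (rule eqs)+
  show "p y \<le> p (Q t)" if "y \<in> U" for y using k(3)[OF that] eqs(1) by simp
qed

lemma D_mono:
  assumes "s \<in> centres" "t \<in> centres" "s \<le> t"
  shows "D s \<le> D t"
proof (rule DERIV_nonneg_imp_increasing_open[OF assms(3)])
  show "continuous_on {s..t} D"
    using Icc_centres[OF assms(1,2)] by (rule continuous_on_subset[OF continuous_D])
  fix r assume "s < r" "r < t"
  then have "h < r" "r < 1 - h" using centres_inner[OF assms(1,2)] by simp_all
  then show "\<exists>d. (D has_real_derivative d) (at r) \<and> 0 \<le> d"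
    using DERIV_D second_difference_nonneg by blast
qed

lemma W_le_of_D_nonneg:
  assumes "s \<in> centres" "t \<in> centres" "s \<le> t" and D: "\<And>r. s < r \<Longrightarrow> r < t \<Longrightarrow> 0 \<le> D r"
  shows "W s \<le> W t"
proof (rule DERIV_nonneg_imp_increasing_open[OF assms(3)])
  show "continuous_on {s..t} W"
    using Icc_centres[OF assms(1,2)] by (rule continuous_on_subset[OF continuous_W])
  fix r assume r: "s < r" "r < t"
  then have "h < r" "r < 1 - h" using centres_inner[OF assms(1,2)] by simp_all
  then show "\<exists>d. (W has_real_derivative d) (at r) \<and> 0 \<le> d"
    using DERIV_W D r by blast
qed

lemma W_ge_of_D_nonpos:
  assumes "s \<in> centres" "t \<in> centres" "s \<le> t" and D: "\<And>r. s < r \<Longrightarrow> r < t \<Longrightarrow> D r \<le> 0"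
  shows "W t \<le> W s"
proof -
  have "- W s \<le> - W t"
  proof (rule DERIV_nonneg_imp_increasing_open[OF assms(3)])
    show "continuous_on {s..t} (\<lambda>r. - W r)"
      using Icc_centres[OF assms(1,2)] by (intro continuous_on_minus continuous_on_subset[OF continuous_W])
    fix r assume r: "s < r" "r < t"
    then have "h < r" "r < 1 - h" using centres_inner[OF assms(1,2)] by simp_all
    then show "\<exists>d. ((\<lambda>r. - W r) has_real_derivative d) (at r) \<and> 0 \<le> d"
      using DERIV_minus[OF DERIV_W[OF \<open>h < r\<close> \<open>r < 1 - h\<close>]] D[OF r] by (intro exI[of _ "- D r"]) simp
  qed
  then show ?thesis by simp
qed

lemma W_strict_of_D_pos:
  assumes "s \<in> centres" "t \<in> centres" "s < t" and D: "\<And>r. s < r \<Longrightarrow> r < t \<Longrightarrow> 0 < D r"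
  shows "W s < W t"
proof (rule DERIV_pos_imp_increasing_open[OF assms(3)])
  show "continuous_on {s..t} W"
    using Icc_centres[OF assms(1,2)] by (rule continuous_on_subset[OF continuous_W])
  fix r assume r: "s < r" "r < t"
  then have "h < r" "r < 1 - h" using centres_inner[OF assms(1,2)] by simp_all
  then show "\<exists>d. (W has_real_derivative d) (at r) \<and> 0 < d"
    using DERIV_W D r by blast
qed

lemma W_strict_of_D_neg:
  assumes "s \<in> centres" "t \<in> centres" "s < t" and D: "\<And>r. s < r \<Longrightarrow> r < t \<Longrightarrow> D r < 0"
  shows "W t < W s"
proof (rule DERIV_neg_imp_decreasing_open[OF assms(3)])
  show "continuous_on {s..t} W"
    using Icc_centres[OF assms(1,2)] by (rule continuous_on_subset[OF continuous_W])
  fix r assume r: "s < r" "r < t"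
  then have "h < r" "r < 1 - h" using centres_inner[OF assms(1,2)] by simp_all
  then show "\<exists>d. (W has_real_derivative d) (at r) \<and> d < 0"
    using DERIV_W D r by blast
qed

section \<open>Minimising over the windows\<close>

definition minimiser :: "real \<Rightarrow> bool" where
  "minimiser t \<longleftrightarrow> t \<in> centres \<and> (\<forall>s\<in>centres. W t \<le> W s)"

lemma minimiser_of_D_0:
  assumes t: "t \<in> centres" and "D t = 0"
  shows "minimiser t"
  unfolding minimiser_def
proof (intro conjI ballI t)
  fix s assume s: "s \<in> centres"
  show "W t \<le> W s"
  proof (cases "t \<le> s")
    case True
    have "0 \<le> D r" if "t < r" "r < s" for r
      using D_mono[OF t, of r] centres_between[OF t s, of r] that \<open>D t = 0\<close> by simp
    then show ?thesis by (rule W_le_of_D_nonneg[OF t s True])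
  next
    case False
    then have "s \<le> t" by simp
    have "D r \<le> 0" if "s < r" "r < t" for r
      using D_mono[OF _ t, of r] centres_between[OF s t, of r] that \<open>D t = 0\<close> by simp
    then show ?thesis by (rule W_ge_of_D_nonpos[OF s t \<open>s \<le> t\<close>])
  qed
qed

text \<open>If \<open>D\<close> has no zero, it has constant sign by the intermediate value theorem. If \<open>D > 0\<close>, then
  \<open>Q (t - h) > 2 * Q t - Q (t + h)\<close> stays bounded below as \<open>t\<close> approaches \<open>h\<close>. So the support is bounded
  below, \<open>h\<close> is an admissible centre, and \<open>W\<close> is smallest there. The case \<open>D < 0\<close> is symmetric.\<close>

lemma minimiser_exists: "\<exists>t. minimiser t"
proof (cases "\<exists>t. h < t \<and> t < 1 - h \<and> D t = 0")
  case True
  then show ?thesis using minimiser_of_D_0 centres_open by blast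
next
  case False
  have half: "h < 1/2" "1/2 < 1 - h" using h by auto
  have half_J: "1/2 \<in> centres" using centres_open half by blast
  have D_nz: "D t \<noteq> 0" if "h < t" "t < 1 - h" for t using False that by blast
  have no_sign_change: False if "h < s" "s \<le> t" "t < 1 - h" "D s < 0" "0 < D t" for s t
  proof -
    have "continuous_on {s..t} D"
      using Icc_centres[OF centres_open centres_open] that by (intro continuous_on_subset[OF continuous_D]) simp
    then have "\<exists>r\<ge>s. r \<le> t \<and> D r = 0" using that by (intro IVT') auto
    then obtain r where "s \<le> r" "r \<le> t" "D r = 0" by blast
    then show False using False that by auto
  qed
  consider "0 < D (1/2)" | "D (1/2) < 0" using D_nz[OF half] by linarith
  then show ?thesis
  proof cases
    case 1
    have D_pos: "0 < D t" if t: "h < t" "t < 1 - h" for t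
    proof (cases "t \<le> 1/2")
      case True
      then have "\<not> D t < 0" using no_sign_change[of t "1/2"] t 1 half by blast
      then show ?thesis using D_nz[OF t] by linarith
    next
      case f: False
      then show ?thesis using D_mono[OF half_J centres_open[OF t]] 1 by simp
    qed
    have "0 \<in> J"
    proof (rule zero_in_J_of_Q_bounded)
      fix u assume u: "0 < u" "u < 1/2 - h"
      have "0 < D (u + h)" using D_pos u by simp
      moreover have "Q h \<le> Q (u + h)" "Q (2 * h + u) \<le> Q (1/2 + h)"
        using u h by (auto intro!: Q_mono J_open_interval)
      moreover have "D (u + h) = Q (2 * h + u) + Q u - 2 * Q (u + h)"
      proof -
        have "u + h + h = 2 * h + u" by linarith
        then show ?thesis unfolding D_def by simp
      qed
      ultimately show "2 * Q h - Q (1/2 + h) \<le> Q u" by linarith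
    qed (use h in auto)
    then have hJ: "h \<in> centres" using J_open_interval[of "h + h"] h by (simp add: centres_def)
    have "W h \<le> W s" if s: "s \<in> centres" for s
    proof (rule W_le_of_D_nonneg[OF hJ s])
      show "h \<le> s" using centres_bounds s by blast
      fix r assume "h < r" "r < s"
      then show "0 \<le> D r" using D_pos[of r] centres_bounds[OF s] by simp
    qed
    then show ?thesis using hJ by (auto simp: minimiser_def)
  next
    case 2
    have D_neg: "D t < 0" if t: "h < t" "t < 1 - h" for t
    proof (cases "1/2 \<le> t")
      case True
      then have "\<not> 0 < D t" using no_sign_change[of "1/2" t] t 2 half by blast
      then show ?thesis using D_nz[OF t] by linarith
    next
      case f: False
      then show ?thesis using D_mono[OF centres_open[OF t] half_J] 2 by simp
    qed
    have "1 \<in> J"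
    proof (rule one_in_J_of_Q_bounded)
      fix u assume u: "1/2 + h < u" "u < 1"
      have "D (u - h) < 0" using D_neg u by simp
      moreover have "Q (u - h) \<le> Q (1 - h)" "Q (1/2 - h) \<le> Q (u - 2 * h)"
        using u h by (auto intro!: Q_mono J_open_interval)
      moreover have "D (u - h) = Q u + Q (u - 2 * h) - 2 * Q (u - h)"
      proof -
        have "u - h - h = u - 2 * h" by linarith
        then show ?thesis unfolding D_def by simp
      qed
      ultimately show "Q u \<le> 2 * Q (1 - h) - Q (1/2 - h)" by linarith
    qed (use h in auto)
    then have hJ: "1 - h \<in> centres" using J_open_interval[of "1 - 2 * h"] h by (simp add: centres_def)
    have "W (1 - h) \<le> W s" if s: "s \<in> centres" for s
    proof (rule W_ge_of_D_nonpos[OF s hJ])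
      show "s \<le> 1 - h" using centres_bounds s by blast
      fix r assume "s < r" "r < 1 - h"
      then show "D r \<le> 0" using D_neg[of r] centres_bounds[OF s] by simp
    qed
    then show ?thesis using hJ by (auto simp: minimiser_def)
  qed
qed

text \<open>The last expression is the lower bound of \<open>cond_abs_error_dual_bound\<close> for a silence set with
  median \<open>Q t\<close>. With the end points of the window centred at \<open>t\<close> it would be \<open>W t\<close> itself. But for
  \<open>t = h\<close> or \<open>t = 1 - h\<close> this window can be unbounded, as for a silence set that is a half-line. So the window
  is taken at a level \<open>t'\<close> that is moved slightly towards \<open>1 / 2\<close>. By the Fenchel inequality this
  costs at most \<open>(t - t') * (2 * Q t - a - b)\<close>. One of the points \<open>a\<close> and \<open>b\<close> may be far away, but its contribution
  has the favourable sign.\<close>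

lemma dual_value_near_minimum:
  assumes min: "minimiser t0" and t: "h \<le> t" "t \<le> 1 - h" and \<delta>: "0 < \<delta>"
  obtains a b where "a \<in> C" "b \<in> C" "a \<le> Q t" "Q t \<le> b"
    "W t0 - \<delta> \<le> b * (t + h) - K b + (a * (t - h) - K a) - 2 * (Q t * t - K (Q t))"
proof -
  have half_J: "1/2 + h \<in> J" "1/2 - h \<in> J" and tJ: "t \<in> J"
    using h t by (auto intro!: J_open_interval)
  define B where "B = \<bar>Q (1/2 + h) - Q t\<bar> + \<bar>Q t - Q (1/2 - h)\<bar>"
  \<comment> \<open>At most \<open>h\<close>, so that \<open>Q t\<close> stays inside the window centred at \<open>t'\<close>.\<close>
  define \<epsilon> where "\<epsilon> = min h (\<delta> / (B + 1))"
  have B: "0 \<le> B" by (simp add: B_def)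
  have \<epsilon>: "0 < \<epsilon>" "\<epsilon> \<le> h" "\<epsilon> \<le> \<delta> / (B + 1)" using h \<delta> B by (auto simp: \<epsilon>_def)
  have "\<epsilon> * B \<le> \<epsilon> * (B + 1)" using \<epsilon> by simp
  also have "\<dots> \<le> \<delta>" using \<epsilon>(3) B by (simp add: pos_le_divide_eq)
  finally have \<epsilon>B: "\<epsilon> * B \<le> \<delta>" .
  define d where "d = \<epsilon> * (1/2 - t)"
  define t' where "t' = t + d"
  define a where "a = Q (t' - h)"
  define b where "b = Q (t' + h)"
  have d_le: "\<bar>d\<bar> \<le> \<epsilon>"
  proof -
    have "\<bar>d\<bar> = \<epsilon> * \<bar>1/2 - t\<bar>" using \<epsilon> by (simp add: d_def abs_mult)
    also have "\<dots> \<le> \<epsilon> * 1" using \<epsilon> t h by (intro mult_left_mono) auto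
    finally show ?thesis by simp
  qed
  have "\<epsilon> < 1" using \<epsilon> h by simp
  have t'_conv: "t' = (1 - \<epsilon>) * t + \<epsilon> * (1/2)" by (simp add: t'_def d_def algebra_simps)
  have "(1 - \<epsilon>) * h + \<epsilon> * h < (1 - \<epsilon>) * t + \<epsilon> * (1/2)"
    using t h \<epsilon> \<open>\<epsilon> < 1\<close> by (intro add_le_less_mono mult_left_mono mult_strict_left_mono) auto
  then have "h < t'" unfolding t'_conv by (simp add: algebra_simps)
  have "(1 - \<epsilon>) * t + \<epsilon> * (1/2) < (1 - \<epsilon>) * (1 - h) + \<epsilon> * (1 - h)"
    using t h \<epsilon> \<open>\<epsilon> < 1\<close> by (intro add_le_less_mono mult_left_mono mult_strict_left_mono) auto
  then have "t' < 1 - h" unfolding t'_conv by (simp add: algebra_simps)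
  note t' = \<open>h < t'\<close> \<open>t' < 1 - h\<close>
  have J: "t' - h \<in> J" "t' + h \<in> J" "t' \<in> J" using t' h by (auto intro!: J_open_interval)
  have "a \<in> C" "b \<in> C" using J by (auto simp: a_def b_def)
  moreover have le: "a \<le> Q t" "Q t \<le> b"
    using J tJ d_le \<epsilon> by (auto simp: a_def b_def t'_def intro!: Q_mono)
  moreover have "W t0 - \<delta> \<le> b * (t + h) - K b + (a * (t - h) - K a) - 2 * (Q t * t - K (Q t))"
  proof -
    have W: "W t0 \<le> W t'" using min centres_open t' by (auto simp: minimiser_def)
    have W_eq: "W t' = ((t' + h) * b - K b) + ((t' - h) * a - K a) - 2 * P t'"
      by (simp add: W_def P_def a_def b_def)
    have d: "d = t' - t" by (simp add: t'_def)
    have "Q t * t' - K (Q t) \<le> P t'" using P_ge[OF J(3), of "Q t"] by (simp add: mult.commute)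
    then have "W t' + d * (2 * Q t - a - b)
        \<le> b * (t + h) - K b + (a * (t - h) - K a) - 2 * (Q t * t - K (Q t))"
      unfolding W_eq d by (simp add: algebra_simps)
    moreover have "- \<delta> \<le> d * (2 * Q t - a - b)"
    proof (cases "t \<le> 1/2")
      case True
      then have d0: "0 \<le> d" using \<epsilon> by (simp add: d_def)
      have "t' \<le> 1/2" unfolding t'_conv using True \<epsilon> \<open>\<epsilon> < 1\<close>
        using mult_left_mono[OF True, of "1 - \<epsilon>"] by (simp add: algebra_simps)
      then have "b \<le> Q (1/2 + h)" unfolding b_def using J half_J by (intro Q_mono) auto
      then have "- B \<le> 2 * Q t - a - b" using le by (simp add: B_def)
      then have "d * (- B) \<le> d * (2 * Q t - a - b)" using d0 by (rule mult_left_mono)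
      moreover have "d * B \<le> \<epsilon> * B" using d_le B by (intro mult_right_mono) auto
      ultimately show ?thesis using \<epsilon>B by simp
    next
      case False
      then have d0: "0 \<le> - d" using \<epsilon> by (simp add: d_def mult_nonneg_nonpos)
      have "1/2 \<le> t'" unfolding t'_conv using False \<epsilon> \<open>\<epsilon> < 1\<close>
        using mult_left_mono[of "1/2" t "1 - \<epsilon>"] by (simp add: algebra_simps diff_divide_distrib)
      then have "Q (1/2 - h) \<le> a" unfolding a_def using J half_J by (intro Q_mono) auto
      then have "- B \<le> - (2 * Q t - a - b)" using le by (simp add: B_def)
      then have "- d * (- B) \<le> - d * (- (2 * Q t - a - b))" using d0 by (rule mult_left_mono)
      then have "d * B \<le> d * (2 * Q t - a - b)" by (simp only: minus_mult_minus)
      moreover have "- d * B \<le> \<epsilon> * B" using d_le B by (intro mult_right_mono) auto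
      ultimately show ?thesis using \<epsilon>B by simp
    qed
    ultimately show ?thesis using W by linarith
  qed
  ultimately show ?thesis using that by blast
qed

text \<open>As \<open>D\<close> is monotone, a nonzero value would keep its sign up to one of the two minimisers, and
  \<open>W\<close> would be strictly monotone there.\<close>

lemma D_0_between_minimisers:
  assumes m: "minimiser s" "minimiser t" and r: "s < r" "r < t"
  shows "D r = 0"
proof (rule ccontr)
  have st: "s \<in> centres" "t \<in> centres" "W s \<le> W r" "W t \<le> W r" "r \<in> centres"
    using m r centres_between[of s t r] by (auto simp: minimiser_def)
  assume "D r \<noteq> 0"
  then consider "0 < D r" | "D r < 0" by linarith
  then show False
  proof cases
    case 1
    have "0 < D q" if "r < q" "q < t" for q
      using D_mono[OF st(5), of q] centres_between[OF st(5,2), of q] 1 that by simp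
    then have "W r < W t" by (rule W_strict_of_D_pos[OF st(5,2) r(2)])
    then show False using st by simp
  next
    case 2
    have "D q < 0" if "s < q" "q < r" for q
      using D_mono[OF _ st(5), of q] centres_between[OF st(1,5), of q] 2 that by simp
    then have "W r < W s" by (rule W_strict_of_D_neg[OF st(1,5) r(1)])
    then show False using st by simp
  qed
qed

text \<open>Where \<open>D\<close> vanishes on an interval, so does its derivative, and the equality case applies to
  every level \<open>r\<close> in between: the density is maximal at both ends of each window, hence on all of it by
  log-concavity. These windows cover the interval from \<open>Q (s - h)\<close> to \<open>Q (t + h)\<close>.\<close>

lemma plateau_between_minimisers:
  assumes m: "minimiser s" "minimiser t" and "s < t"
  obtains c where "0 < c" "\<And>x. Q (s - h) < x \<Longrightarrow> x < Q (t + h) \<Longrightarrow> p x = c"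
proof -
  have J: "s \<in> centres" "t \<in> centres" using m by (auto simp: minimiser_def)
  have shiftJ: "s - h \<in> J" "t + h \<in> J" using J by (auto simp: centres_def)
  have flat: "p (Q (r + h)) = p (Q r)" "p (Q (r - h)) = p (Q r)" "\<And>y. y \<in> U \<Longrightarrow> p y \<le> p (Q r)"
    and r_bounds: "h < r" "r < 1 - h" if r: "s < r" "r < t" for r
  proof -
    show rb: "h < r" "r < 1 - h" using centres_inner[OF J] r by simp_all
    have "(D has_real_derivative 0) (at r)"
    proof (rule has_field_derivative_transform_within_open[where S = "{s<..<t}"])
      show "((\<lambda>_. 0) has_real_derivative 0) (at r)" by simp
      show "0 = D q" if "q \<in> {s<..<t}" for q
        using D_0_between_minimisers[OF m, of q] that by simp
    qed (use r in auto)
    then have "1 / p (Q (r + h)) + 1 / p (Q (r - h)) - 2 * (1 / p (Q r)) = 0"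
      using DERIV_D[OF rb] DERIV_unique by blast
    from second_difference_eq_0[OF rb this]
    show "p (Q (r + h)) = p (Q r)" "p (Q (r - h)) = p (Q r)" "\<And>y. y \<in> U \<Longrightarrow> p y \<le> p (Q r)" .
  qed
  define r0 where "r0 = (s + t) / 2"
  define c where "c = p (Q r0)"
  have r0: "s < r0" "r0 < t" using \<open>s < t\<close> by (auto simp: r0_def)
  have QU: "Q r \<in> U" if "s < r" "r < t" for r
    using r_bounds[OF that] h by (intro Q_in_U) auto
  have same: "p (Q r) = c" if r: "s < r" "r < t" for r
    unfolding c_def using flat(3)[OF r QU[OF r0]] flat(3)[OF r0 QU[OF r]] by simp
  have "0 < c" unfolding c_def using p_pos_U QU r0 by blast
  moreover have "p x = c" if x: "Q (s - h) < x" "x < Q (t + h)" for x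
  proof (rule antisym)
    have xU: "x \<in> U" using interior_C[OF _ _ x] shiftJ by simp
    then show "p x \<le> c" unfolding c_def by (rule flat(3)[OF r0])
    have xC: "x \<in> C" using xU U_subset_C by blast
    have "s - h < F x" "F x < t + h"
      using F_strict_mono[OF _ xC x(1)] F_strict_mono[OF xC _ x(2)] shiftJ by auto
    \<comment> \<open>A level \<open>r\<close> between the two minimisers whose window contains \<open>x\<close>.\<close>
    then have "max s (F x - h) < min t (F x + h)" using \<open>s < t\<close> h by auto
    then obtain r where "max s (F x - h) < r" "r < min t (F x + h)" using dense by blast
    then have r: "s < r" "r < t" "r - h < F x" "F x < r + h" by auto
    note rb = r_bounds[OF r(1,2)]
    have rJ: "r - h \<in> J" "r + h \<in> J" using rb h by (auto intro!: J_open_interval)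
    have "Q (r - h) \<le> x" "x \<le> Q (r + h)"
      using Q_mono[OF rJ(1) F_in_J[OF xC]] Q_mono[OF F_in_J[OF xC] rJ(2)] r xC by simp_all
    with flat(1,2)[OF r(1,2)] same[OF r(1,2)] show "c \<le> p x"
      using \<open>0 < c\<close> by (intro log_concave_between_le[OF lc, of "Q (r - h)" c "Q (r + h)"]) auto
  qed
  ultimately show ?thesis using that by blast
qed

lemma two_minimisers_plateau:
  assumes m: "minimiser u" "minimiser v" and "u < v"
  shows "\<exists>c>0. (\<forall>x. p x \<le> c) \<and> Q (u - h) < Q (v + h) \<and>
    (\<forall>x. Q (u - h) < x \<and> x < Q (v + h) \<longrightarrow> p x = c) \<and>
    c * (Q (v + h) - Q (u - h)) = v - u + 2 * h"
proof -
  obtain c where c: "0 < c" and plateau: "\<And>x. Q (u - h) < x \<Longrightarrow> x < Q (v + h) \<Longrightarrow> p x = c"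
    using plateau_between_minimisers[OF m \<open>u < v\<close>] by blast
  have J: "u - h \<in> J" "v + h \<in> J" using m by (auto simp: minimiser_def centres_def)
  have less: "Q (u - h) < Q (v + h)" using J \<open>u < v\<close> h by (intro Q_strict_mono) auto
  have "F (Q (v + h)) - F (Q (u - h)) = c * (Q (v + h) - Q (u - h))"
    using less c by (intro measure_plateau plateau) auto
  then have "c * (Q (v + h) - Q (u - h)) = v - u + 2 * h" using J by simp
  then show ?thesis
    using c plateau less log_concave_plateau_maximal[OF lc less c plateau] by (intro exI[of _ c]) simp
qed

text \<open>Each minimiser \<open>r\<close> is paired with a different one, so that its window lies in a
  plateau. All plateaus have the same height since it is the maximum of the density.\<close>

lemma minimal_window_length:
  assumes m: "minimiser u" "minimiser v" "u < v" and r: "minimiser r"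
    and c: "\<And>x. p x \<le> c" "p y = c"
  shows "c * (Q (r + h) - Q (r - h)) = 2 * h"
proof -
  obtain u' v' where uv: "minimiser u'" "minimiser v'" "u' < v'" "u' \<le> r" "r \<le> v'"
  proof (cases "u < r")
    case True then show ?thesis using that[of u r] m r by simp
  next
    case False then show ?thesis using that[of r v] m r by simp
  qed
  obtain c' where c': "0 < c'" "\<forall>x. p x \<le> c'" "Q (u' - h) < Q (v' + h)"
    "\<forall>x. Q (u' - h) < x \<and> x < Q (v' + h) \<longrightarrow> p x = c'"
    using two_minimisers_plateau[OF uv(1-3)] by (elim exE conjE)
  obtain z where "Q (u' - h) < z" "z < Q (v' + h)" using dense c'(3) by blast
  then have "p z = c'" using c'(4) by blast
  then have "c' = c" using c'(2)[rule_format, of y] c(1)[of z] c(2) by linarith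
  have J: "u' - h \<in> J" "v' + h \<in> J" "r - h \<in> J" "r + h \<in> J"
    using uv r by (auto simp: minimiser_def centres_def)
  have sub: "Q (u' - h) \<le> Q (r - h)" "Q (r + h) \<le> Q (v' + h)" "Q (r - h) \<le> Q (r + h)"
    using J uv h by (auto intro!: Q_mono)
  have "F (Q (r + h)) - F (Q (r - h)) = c' * (Q (r + h) - Q (r - h))"
  proof (rule measure_plateau[OF sub(3)])
    fix x assume "Q (r - h) < x" "x < Q (r + h)"
    then show "p x = c'" using sub by (intro c'(4)[rule_format] conjI) linarith+
  qed (use c'(1) in simp)
  then show ?thesis using J \<open>c' = c\<close> by simp
qed

text \<open>On a plateau the median of an interval is its midpoint, so \<open>D\<close> vanishes.\<close>

lemma plateau_window_minimiser:
  assumes c: "0 < c" and plateau: "\<And>x. a < x \<Longrightarrow> x < b \<Longrightarrow> p x = c" and len: "c * (b - a) = 2 * h"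
  shows "F b - F a = 2 * h" "minimiser (F a + h)"
proof -
  have ab: "a < b"
  proof (rule ccontr)
    assume "\<not> a < b"
    then have "c * (b - a) \<le> 0" using c by (intro mult_nonneg_nonpos) auto
    then show False using len h by simp
  qed
  have F_plateau: "F y - F x = c * (y - x)" if "a \<le> x" "x \<le> y" "y \<le> b" for x y
    using that c by (intro measure_plateau plateau) auto
  show Fab: "F b - F a = 2 * h" using F_plateau[of a b] ab len by simp
  have "{a<..<b} \<subseteq> U"
  proof
    fix z assume z: "z \<in> {a<..<b}"
    then have "0 < F z - F a" "0 < F b - F z"
      using F_plateau[of a z] F_plateau[of z b] c by simp_all
    then show "z \<in> U" using F_bounds(1)[of a] F_bounds(2)[of b] unfolding U_def mem_Collect_eq by linarith
  qed
  then have "closure {a<..<b} \<subseteq> C" unfolding C_def by (rule closure_mono)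
  then have C: "{a..b} \<subseteq> C" using ab by simp
  define m where "m = (a + b) / 2"
  have m: "a \<le> m" "m \<le> b" using ab by (auto simp: m_def)
  have "F m - F a = c * (m - a)" using F_plateau m by simp
  also have "c * (m - a) = h" using len by (simp add: m_def field_simps)
  finally have Fm: "F a + h = F m" by simp
  have FF: "F m + h = F b" "F m - h = F a" using Fm Fab by linarith+
  have mem: "a \<in> C" "b \<in> C" "m \<in> C" using C ab m by auto
  show "minimiser (F a + h)" unfolding Fm
  proof (rule minimiser_of_D_0)
    show "F m \<in> centres" unfolding centres_def mem_Collect_eq FF using mem by simp
    show "D (F m) = 0" unfolding D_def FF using mem by (simp add: m_def)
  qed
qed

end

section \<open>Conditional medians and conditional errors\<close>

locale log_concave_variable = log_concave_law p for p :: "real \<Rightarrow> real" +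
  fixes M :: "'a measure" and X :: "'a \<Rightarrow> real"
  assumes prob_M: "prob_space M"
    and dist: "distributed M lborel X (\<lambda>x. ennreal (p x))"
begin

sublocale M: prob_space M by (rule prob_M)

lemma X_measurable [measurable]: "X \<in> borel_measurable M"
  using distributed_measurable[OF dist] by simp

lemma distr_X: "distr M lborel X = N"
  using distributed_distr_eq_density[OF dist] by (simp add: N_def)

lemma emeasure_X:
  assumes "S \<in> sets borel"
  shows "emeasure M {\<omega> \<in> space M. X \<omega> \<in> S} = emeasure N S"
  unfolding distr_X[symmetric] using assms
  by (subst emeasure_distr) (auto simp: vimage_def Int_def conj_commute)

lemma measure_X:
  assumes "S \<in> sets borel"
  shows "measure M {\<omega> \<in> space M. X \<omega> \<in> S} = measure N S"
  using emeasure_X[OF assms] by (simp add: measure_def)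

lemma silence_mass_eq: "S \<in> sets borel \<Longrightarrow> silence_mass M X S = measure N S"
  by (simp add: silence_mass_def measure_X)

lemma is_cond_median_iff:
  assumes S: "S \<in> sets borel" and pos: "0 < measure N S"
  shows "is_cond_median M X S m \<longleftrightarrow>
    measure N S / 2 \<le> measure N (S \<inter> {..m}) \<and> measure N S / 2 \<le> measure N (S \<inter> {m..})"
proof -
  have "{\<omega> \<in> space M. X \<omega> \<le> m \<and> X \<omega> \<in> S} = {\<omega> \<in> space M. X \<omega> \<in> S \<inter> {..m}}"
    "{\<omega> \<in> space M. m \<le> X \<omega> \<and> X \<omega> \<in> S} = {\<omega> \<in> space M. X \<omega> \<in> S \<inter> {m..}}"
    by auto
  then have "cond_prob M (\<lambda>\<omega>. X \<omega> \<le> m) (\<lambda>\<omega>. X \<omega> \<in> S) = measure N (S \<inter> {..m}) / measure N S"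
    "cond_prob M (\<lambda>\<omega>. m \<le> X \<omega>) (\<lambda>\<omega>. X \<omega> \<in> S) = measure N (S \<inter> {m..}) / measure N S"
    unfolding cond_prob_def using S by (simp_all only: measure_X sets.Int atMost_borel atLeast_borel)
  then show ?thesis
    unfolding is_cond_median_def using pos by (simp add: le_divide_eq)
qed

text \<open>The choice in the definition of \<open>cond_median\<close> has a witness: the restriction of the law to \<open>S\<close> has no
  atoms, so its distribution function takes the value that is half of the total mass.\<close>

lemma cond_median_is_median:
  assumes S: "S \<in> sets borel" and pos: "0 < measure N S"
  shows "is_cond_median M X S (cond_median M X S)"
proof -
  define R where "R = density N (indicator S)"
  have R: "emeasure R A = emeasure N (S \<inter> A)" if "A \<in> sets borel" for A
    unfolding R_def using that S by (intro emeasure_restricted) auto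
  have mR: "measure R A = measure N (S \<inter> A)" if "A \<in> sets borel" for A
    using R[OF that] by (simp add: measure_def)
  have space_R: "space R = UNIV" by (simp add: R_def)
  have "finite_measure R"
    by (rule finite_measureI) (use R[of UNIV] in \<open>simp add: space_R N.emeasure_eq_measure\<close>)
  then interpret R: finite_borel_measure R
    by (intro finite_borel_measure.intro finite_borel_measure_axioms.intro) (simp_all add: R_def)
  have "measure R {x} = 0" for x
  proof -
    have "measure N (S \<inter> {x}) \<le> measure N {x}" by (intro N.finite_measure_mono) auto
    then show ?thesis using mR[of "{x}"] measure_nonneg[of N "S \<inter> {x}"] by simp
  qed
  moreover have "measure R (space R) = measure N S" using mR[of UNIV] by (simp add: space_R)
  ultimately obtain m where "cdf R m = measure N S / 2"
    using R.cdf_attains[of "measure N S / 2"] pos by auto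
  then have "measure N (S \<inter> {..m}) = measure N S / 2" using mR[of "{..m}"] by (simp add: cdf_def)
  then have "is_cond_median M X S m"
    using is_cond_median_iff[OF S pos, of m] measure_Int_Ici(1)[OF S, of m] by simp
  then show ?thesis unfolding cond_median_def by (rule someI)
qed

lemma cond_median_mass:
  assumes S: "S \<in> sets borel" and pos: "0 < measure N S"
  shows "measure N (S \<inter> {..cond_median M X S}) = measure N S / 2"
    and "measure N (S \<inter> {cond_median M X S..}) = measure N S / 2"
    and "measure N (S \<inter> {..<cond_median M X S}) = measure N S / 2"
  using cond_median_is_median[OF S pos] measure_Int_Ici[OF S, of "cond_median M X S"]
  unfolding is_cond_median_iff[OF S pos] by linarith+

lemma cond_abs_error_eq:
  assumes S: "S \<in> sets borel"
  shows "cond_abs_error M X S =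
    (\<integral>\<^sup>+x. ennreal \<bar>x - cond_median M X S\<bar> * indicator S x \<partial>N) / emeasure N S"
proof -
  let ?m = "cond_median M X S"
  let ?A = "{\<omega> \<in> space M. X \<omega> \<in> S}"
  have A: "?A \<in> sets M" using S by measurable
  have "cond_abs_error M X S = (\<integral>\<^sup>+\<omega>. ennreal \<bar>X \<omega> - ?m\<bar> * indicator ?A \<omega> \<partial>M) / emeasure M ?A"
    unfolding cond_abs_error_def
    by (rule nn_integral_uniform_measure[OF _ A]) measurable
  also have "(\<integral>\<^sup>+\<omega>. ennreal \<bar>X \<omega> - ?m\<bar> * indicator ?A \<omega> \<partial>M)
      = (\<integral>\<^sup>+\<omega>. ennreal \<bar>X \<omega> - ?m\<bar> * indicator S (X \<omega>) \<partial>M)"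
    by (intro nn_integral_cong) (simp add: indicator_def)
  also have "\<dots> = (\<integral>\<^sup>+x. ennreal \<bar>x - ?m\<bar> * indicator S x \<partial>N)"
    unfolding distr_X[symmetric] using S by (subst nn_integral_distr) auto
  finally show ?thesis by (simp add: emeasure_X[OF S])
qed

lemma same_silence_set_iff:
  assumes "S \<in> sets borel" "T \<in> sets borel"
  shows "same_silence_set M X S T \<longleftrightarrow> (AE x in N. x \<in> S \<longleftrightarrow> x \<in> T)"
  unfolding same_silence_set_def distr_X[symmetric] using assms
  by (subst AE_distr_iff) (auto simp: pred_def)

text \<open>Sets that differ by a null set have the same conditional medians, so that \<open>cond_median\<close> chooses the
  same one for both.\<close>

lemma same_silence_set_cong:
  assumes S: "S \<in> sets borel" and T: "T \<in> sets borel" and same: "same_silence_set M X S T"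
  shows "measure N S = measure N T" "cond_abs_error M X S = cond_abs_error M X T"
proof -
  have ae: "AE x in N. x \<in> S \<longleftrightarrow> x \<in> T" using same by (simp add: same_silence_set_iff S T)
  have eq: "emeasure N (S \<inter> A) = emeasure N (T \<inter> A)" if "A \<in> sets borel" for A
    using ae S T that by (intro emeasure_eq_AE) auto
  have eqm: "measure N (S \<inter> A) = measure N (T \<inter> A)" if "A \<in> sets borel" for A
    using eq[OF that] by (simp add: measure_def)
  show mass: "measure N S = measure N T" using eqm[of UNIV] by simp
  show "cond_abs_error M X S = cond_abs_error M X T"
  proof (cases "measure N S = 0")
    case True
    then show ?thesis
      using mass S T cond_abs_error_null[OF prob_M X_measurable] by (simp add: silence_mass_eq)
  next
    case False
    then have pos: "0 < measure N S" "0 < measure N T"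
      using mass measure_nonneg[of N S] by linarith+
    have "is_cond_median M X S = is_cond_median M X T"
      by (rule ext) (simp add: is_cond_median_iff[OF S pos(1)] is_cond_median_iff[OF T pos(2)] mass eqm)
    then have med: "cond_median M X S = cond_median M X T" by (simp add: cond_median_def)
    have "(\<integral>\<^sup>+x. ennreal \<bar>x - cond_median M X S\<bar> * indicator S x \<partial>N) =
        (\<integral>\<^sup>+x. ennreal \<bar>x - cond_median M X S\<bar> * indicator T x \<partial>N)"
      using ae by (intro nn_integral_cong_AE) (auto simp: indicator_def)
    then show ?thesis
      using eq[of UNIV] by (simp add: cond_abs_error_eq S T med)
  qed
qed

lemma same_silence_set_Icc:
  assumes F: "F a = F a'" "F b = F b'"
  shows "same_silence_set M X {a..b} {a'..b'}"
proof -
  have null: "AE x in N. x \<notin> {min y y'..max y y'}" if "F y = F y'" for y y'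
  proof -
    have "measure N {min y y'..max y y'} = 0"
      using that measure_Icc[of "min y y'" "max y y'"] by (simp add: min_def max_def)
    then have "{min y y'..max y y'} \<in> null_sets N"
      by (intro null_setsI) (auto simp: N.emeasure_eq_measure)
    then show ?thesis by (rule AE_not_in)
  qed
  have "AE x in N. x \<in> {a..b} \<longleftrightarrow> x \<in> {a'..b'}"
    using null[OF F(1)] null[OF F(2)] by eventually_elim auto
  then show ?thesis by (simp add: same_silence_set_iff)
qed

end

locale silence_window = log_concave_variable p M X + log_concave_window p h
  for p :: "real \<Rightarrow> real" and M :: "'a measure" and X :: "'a \<Rightarrow> real" and h :: real
begin

lemma cond_median_window:
  assumes t: "t \<in> centres"
  shows "cond_median M X {Q (t - h)..Q (t + h)} = Q t"
proof -
  let ?S = "{Q (t - h)..Q (t + h)}"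
  let ?m = "cond_median M X ?S"
  have J: "t - h \<in> J" "t + h \<in> J" using t by (auto simp: centres_def)
  have le: "Q (t - h) \<le> Q (t + h)" using J h by (intro Q_mono) auto
  have mass: "measure N ?S = 2 * h" using measure_Icc[OF le] J by simp
  have med: "measure N (?S \<inter> {..?m}) = h" using cond_median_mass(1)[of ?S] mass h by simp
  have upper: "?m \<le> Q (t + h)"
  proof (rule ccontr)
    assume "\<not> ?thesis"
    then have "?S \<inter> {..?m} = ?S" by auto
    then have "measure N ?S = h" using med by (simp only:)
    then show False using mass h by linarith
  qed
  have lower: "Q (t - h) \<le> ?m"
  proof (rule ccontr)
    assume "\<not> ?thesis"
    then have "?S \<inter> {..?m} = {}" by auto
    then have "measure N {} = h" using med by (simp only:)
    then show False using h by simp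
  qed
  from upper have "?S \<inter> {..?m} = {Q (t - h)..?m}" by auto
  then have "measure N {Q (t - h)..?m} = h" using med by (simp only:)
  then have "F ?m = t" using measure_Icc[OF lower] F_Q[OF J(1)] by linarith
  from Q_eqI[OF this centres_unit(1)[OF t] centres_unit(2)[OF t]] show ?thesis by (rule sym)
qed

lemma cond_abs_error_window:
  assumes t: "t \<in> centres"
  shows "cond_abs_error M X {Q (t - h)..Q (t + h)} = ennreal (W t / (2 * h))"
proof -
  define a m b where "a = Q (t - h)" and "m = Q t" and "b = Q (t + h)"
  have J: "t - h \<in> J" "t \<in> J" "t + h \<in> J" using t centres_in_J[OF t] by (auto simp: centres_def)
  have abC: "a \<in> C" "m \<in> C" "b \<in> C" using J by (auto simp: a_def m_def b_def)
  have le: "a \<le> m" "m \<le> b" using J h by (auto simp: a_def m_def b_def intro!: Q_mono)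
  have FF: "F a = t - h" "F m = t" "F b = t + h" using J by (auto simp: a_def m_def b_def)
  have W_eq: "W t = ((t + h) * b - K b) + ((t - h) * a - K a) - 2 * (t * m - K m)"
    unfolding W_def P_def a_def m_def b_def ..
  have "((\<lambda>x. \<bar>x - m\<bar> * p x) has_integral
      - (((m - m) * F m - K m) - ((a - m) * F a - K a))) {a..m}"
    by (rule has_integral_eq[OF _ has_integral_neg[OF first_moment_has_integral[OF abC(1,2) le(1), of m]]])
       (simp add: left_diff_distrib)
  moreover have "((\<lambda>x. \<bar>x - m\<bar> * p x) has_integral
      ((b - m) * F b - K b) - ((m - m) * F m - K m)) {m..b}"
    by (rule has_integral_eq[OF _ first_moment_has_integral[OF abC(2,3) le(2), of m]]) simp
  ultimately have "((\<lambda>x. \<bar>x - m\<bar> * p x) has_integral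
      - (((m - m) * F m - K m) - ((a - m) * F a - K a)) +
      (((b - m) * F b - K b) - ((m - m) * F m - K m))) {a..b}"
    by (rule has_integral_combine[OF le])
  also have "- (((m - m) * F m - K m) - ((a - m) * F a - K a)) +
      (((b - m) * F b - K b) - ((m - m) * F m - K m)) = W t"
    unfolding FF W_eq by (simp add: algebra_simps)
  finally have "(\<integral>\<^sup>+x. ennreal \<bar>x - m\<bar> * indicator {a..b} x \<partial>N) = ennreal (W t)"
    by (intro nn_integral_N_Icc) auto
  moreover have "emeasure N {a..b} = ennreal (2 * h)"
    using measure_Icc[of a b] le by (simp add: N.emeasure_eq_measure FF)
  ultimately show ?thesis
    using cond_abs_error_eq[of "{a..b}"] cond_median_window[OF t] h W_nonneg[OF t]
    by (simp add: a_def m_def b_def divide_ennreal)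
qed

lemma window_of_interval:
  assumes "F b - F a = 2 * h"
  shows "F a + h \<in> centres" "same_silence_set M X {a..b} {Q (F a + h - h)..Q (F a + h + h)}"
proof -
  have Fb: "F b = F a + h + h" using assms by simp
  have "F a + h + h \<in> J" using F_in_J_always[of b] unfolding Fb .
  then show "F a + h \<in> centres" using F_in_J_always[of a] by (simp add: centres_def)
  show "same_silence_set M X {a..b} {Q (F a + h - h)..Q (F a + h + h)}"
    unfolding Fb[symmetric] by (rule same_silence_set_Icc) (simp_all add: F_in_J_always)
qed

lemma cond_abs_error_interval:
  assumes "F b - F a = 2 * h"
  shows "cond_abs_error M X {a..b} = ennreal (W (F a + h) / (2 * h))"
  using same_silence_set_cong(2)[OF _ _ window_of_interval(2)[OF assms]]
    cond_abs_error_window[OF window_of_interval(1)[OF assms]] by simp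

text \<open>Let \<open>r x\<close> be \<open>b - x\<close> on \<open>{m..b}\<close>, \<open>x - a\<close> on \<open>{a..m}\<close> and 0 elsewhere. On \<open>T\<close> the sum \<open>\<bar>x - m\<bar> + r x\<close> is at least
  \<open>b - m\<close> to the right of \<open>m\<close> and at least \<open>m - a\<close> to the left, and \<open>T\<close> has half of its mass on either side.
  The integral of \<open>r\<close> over \<open>T\<close> is at most its integral over the whole line, which is expressed by \<open>K\<close>.
  Since that integral is nonnegative, normalising by the mass of \<open>T\<close>, which may exceed \<open>2 * h\<close>, only helps.\<close>

lemma cond_abs_error_dual_bound:
  assumes T: "T \<in> sets borel" and mass: "2 * h \<le> measure N T"
    and m: "m = cond_median M X T" and mC: "m \<in> C"
    and ab: "a \<in> C" "b \<in> C" "a \<le> m" "m \<le> b"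
  shows "ennreal ((b * (F m + h) - K b + (a * (F m - h) - K a) - 2 * (m * F m - K m)) / (2 * h))
    \<le> cond_abs_error M X T"
proof -
  define \<tau> where "\<tau> = measure N T"
  have \<tau>: "0 < \<tau>" "2 * h \<le> \<tau>" using mass h by (auto simp: \<tau>_def)
  define E where "E = (\<integral>\<^sup>+x. ennreal \<bar>x - m\<bar> * indicator T x \<partial>N)"
  define R1 where "R1 = - (((b - b) * F b - K b) - ((m - b) * F m - K m))"
  define R2 where "R2 = ((m - a) * F m - K m) - ((a - a) * F a - K a)"
  have "((\<lambda>x. (b - x) * p x) has_integral R1) {m..b}"
    unfolding R1_def
    by (rule has_integral_eq[OF _ has_integral_neg[OF first_moment_has_integral[OF mC ab(2,4), of b]]])
       (simp add: algebra_simps)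
  then have R1: "(\<integral>\<^sup>+x. ennreal (b - x) * indicator {m..b} x \<partial>N) = ennreal R1"
    by (intro nn_integral_N_Icc) auto
  have R2: "(\<integral>\<^sup>+x. ennreal (x - a) * indicator {a..m} x \<partial>N) = ennreal R2"
    unfolding R2_def by (intro nn_integral_N_Icc first_moment_has_integral ab mC) auto
  have R1_nonneg: "0 \<le> R1"
    using K_above_tangent[of m b] by (simp add: R1_def algebra_simps)
  have R2_nonneg: "0 \<le> R2"
    using K_above_tangent[of m a] by (simp add: R2_def algebra_simps)
  have "measure N (T \<inter> {m..}) = \<tau> / 2" "measure N (T \<inter> {..<m}) = \<tau> / 2"
    unfolding m \<tau>_def using \<tau> by (intro cond_median_mass[OF T]; simp add: \<tau>_def)+
  then have halves: "emeasure N (T \<inter> {m..}) = ennreal (\<tau> / 2)"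
    "emeasure N (T \<inter> {..<m}) = ennreal (\<tau> / 2)"
    by (simp_all only: N.emeasure_eq_measure)
  have "ennreal ((b - m) * (\<tau> / 2) + (m - a) * (\<tau> / 2)) =
      ennreal (b - m) * emeasure N (T \<inter> {m..}) + ennreal (m - a) * emeasure N (T \<inter> {..<m})"
    unfolding halves using \<tau> ab
    by (simp only: ennreal_mult'[symmetric] ennreal_plus[symmetric] diff_ge_0_iff_ge
        mult_nonneg_nonneg half_gt_zero less_imp_le)
  also have "\<dots> = (\<integral>\<^sup>+x. ennreal (b - m) * indicator (T \<inter> {m..}) x +
      ennreal (m - a) * indicator (T \<inter> {..<m}) x \<partial>N)"
    using T by (simp add: nn_integral_add nn_integral_cmult_indicator)
  also have "\<dots> \<le> (\<integral>\<^sup>+x. ennreal \<bar>x - m\<bar> * indicator T x +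
      (ennreal (b - x) * indicator {m..b} x + ennreal (x - a) * indicator {a..m} x) \<partial>N)"
  proof (rule nn_integral_mono)
    fix x
    consider "x \<notin> T" | "x \<in> T" "x < a" | "x \<in> T" "a \<le> x" "x < m"
      | "x \<in> T" "m \<le> x" "x \<le> b" | "x \<in> T" "b < x" by linarith
    then show "ennreal (b - m) * indicator (T \<inter> {m..}) x + ennreal (m - a) * indicator (T \<inter> {..<m}) x
      \<le> ennreal \<bar>x - m\<bar> * indicator T x +
        (ennreal (b - x) * indicator {m..b} x + ennreal (x - a) * indicator {a..m} x)"
    proof cases
      case 1 then show ?thesis by simp
    next
      case 2 then show ?thesis using ab by (auto intro!: ennreal_leI)
    next
      case 3
      then have "ennreal (m - a) = ennreal \<bar>x - m\<bar> + ennreal (x - a)"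
        by (subst ennreal_plus[symmetric]) auto
      then show ?thesis using 3 by simp
    next
      case 4
      then have "ennreal (b - m) = ennreal \<bar>x - m\<bar> + ennreal (b - x)"
        by (subst ennreal_plus[symmetric]) auto
      then show ?thesis using 4 by (auto simp: add_increasing2)
    next
      case 5 then show ?thesis using ab by (auto intro!: ennreal_leI)
    qed
  qed
  also have "\<dots> = E + (ennreal R1 + ennreal R2)"
    unfolding E_def R1[symmetric] R2[symmetric] using T
    by (subst nn_integral_add; simp)+
  also have "\<dots> = E + ennreal (R1 + R2)" using R1_nonneg R2_nonneg by simp
  finally have main: "ennreal ((b - a) * (\<tau> / 2)) \<le> E + ennreal (R1 + R2)"
    by (simp add: algebra_simps diff_divide_distrib)
  define L where "L = (b - a) / 2 - (R1 + R2) / (2 * h)"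
  have "L * \<tau> + (R1 + R2) \<le> (b - a) * (\<tau> / 2)"
  proof -
    have "R1 + R2 = (R1 + R2) / (2 * h) * (2 * h)" using h by simp
    also have "\<dots> \<le> (R1 + R2) / (2 * h) * \<tau>"
      using R1_nonneg R2_nonneg h \<tau> by (intro mult_left_mono) auto
    finally have "R1 + R2 \<le> (R1 + R2) / (2 * h) * \<tau>" .
    moreover have "L * \<tau> = (b - a) * (\<tau> / 2) - (R1 + R2) / (2 * h) * \<tau>"
      unfolding L_def by (simp add: left_diff_distrib diff_divide_distrib)
    ultimately show ?thesis by linarith
  qed
  then have "ennreal (L * \<tau> + (R1 + R2)) \<le> ennreal ((b - a) * (\<tau> / 2))" by (rule ennreal_leI)
  also note main
  finally have ineq: "ennreal (L * \<tau> + (R1 + R2)) \<le> E + ennreal (R1 + R2)" .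
  have "ennreal (L * \<tau>) \<le> E"
  proof (cases "0 \<le> L * \<tau>")
    case True
    then have "ennreal (L * \<tau>) + ennreal (R1 + R2) \<le> E + ennreal (R1 + R2)"
      using ineq R1_nonneg R2_nonneg by (simp add: ennreal_plus)
    then show ?thesis by (simp add: add.commute[of _ "ennreal (R1 + R2)"] ennreal_add_left_cancel_le)
  qed (simp add: ennreal_neg)
  then have "ennreal L * ennreal \<tau> / ennreal \<tau> \<le> E / ennreal \<tau>"
    using \<tau> by (intro divide_right_mono_ennreal) (simp add: ennreal_mult'')
  then have "ennreal L \<le> E / ennreal \<tau>"
    using \<tau> by (simp add: ennreal_mult_divide_eq)
  also have "E / ennreal \<tau> = cond_abs_error M X T"
    using cond_abs_error_eq[OF T] by (simp add: E_def m \<tau>_def N.emeasure_eq_measure)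
  also have "L = (b * (F m + h) - K b + (a * (F m - h) - K a) - 2 * (m * F m - K m)) / (2 * h)"
    using h by (simp add: L_def R1_def R2_def field_simps)
  finally show ?thesis .
qed

lemma cond_abs_error_ge_minimum:
  assumes min: "minimiser t0" and T: "T \<in> sets borel" and mass: "2 * h \<le> measure N T"
  shows "ennreal (W t0 / (2 * h)) \<le> cond_abs_error M X T"
proof -
  define m where "m = cond_median M X T"
  define t where "t = F m"
  have pos: "0 < measure N T" using mass h by simp
  have "h \<le> measure N (T \<inter> {..m})" "h \<le> measure N (T \<inter> {m..})"
    using cond_median_mass[OF T pos] mass by (simp_all add: m_def)
  moreover have "measure N (T \<inter> {..m}) \<le> F m"
    unfolding measure_Iic[symmetric] using T by (intro N.finite_measure_mono) auto
  moreover have "measure N (T \<inter> {m..}) \<le> 1 - F m"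
    using measure_Int_Ici(1)[of UNIV m] N.finite_measure_mono[of "T \<inter> {m..}" "{m..}"] N.prob_space
    by (simp add: measure_Iic)
  ultimately have t: "h \<le> t" "t \<le> 1 - h" by (auto simp: t_def)
  then have "0 < F m" "F m < 1" using h by (auto simp: t_def)
  then have m_eq: "Q t = m" and mC: "m \<in> C"
    using Q_eqI[of m t] U_subset_C by (auto simp: t_def U_def)
  have approx: "ennreal ((W t0 - \<delta>) / (2 * h)) \<le> cond_abs_error M X T" if \<delta>: "0 < \<delta>" for \<delta>
  proof -
    obtain a b where ab: "a \<in> C" "b \<in> C" "a \<le> Q t" "Q t \<le> b"
      "W t0 - \<delta> \<le> b * (t + h) - K b + (a * (t - h) - K a) - 2 * (Q t * t - K (Q t))"
      using dual_value_near_minimum[OF min t \<delta>] by blast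
    have "ennreal ((W t0 - \<delta>) / (2 * h)) \<le>
        ennreal ((b * (t + h) - K b + (a * (t - h) - K a) - 2 * (m * t - K m)) / (2 * h))"
      using ab(5) h by (intro ennreal_leI divide_right_mono) (simp_all add: m_eq)
    also have "\<dots> \<le> cond_abs_error M X T"
      using cond_abs_error_dual_bound[OF T mass m_def mC ab(1,2) ab(3,4)[unfolded m_eq]]
      unfolding t_def .
    finally show ?thesis .
  qed
  show ?thesis
  proof (cases "cond_abs_error M X T")
    case (real e)
    have "W t0 / (2 * h) \<le> e"
    proof (rule field_le_epsilon)
      fix \<delta> :: real assume "0 < \<delta>"
      then have "ennreal ((W t0 - 2 * h * \<delta>) / (2 * h)) \<le> ennreal e"
        using approx[of "2 * h * \<delta>"] h real by simp
      then have "(W t0 - 2 * h * \<delta>) / (2 * h) \<le> e" using real by (simp add: ennreal_le_iff)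
      then show "W t0 / (2 * h) \<le> e + \<delta>" using h by (simp add: diff_divide_distrib)
    qed
    then show ?thesis using real by (simp add: ennreal_leI)
  qed simp
qed

section \<open>Optimal intervals\<close>

text \<open>Since a window of mass \<open>2 * h\<close> exists, unbounded candidates are excluded.\<close>

lemma optimal_interval_iff:
  "optimal_interval M X (2 * h) S \<longleftrightarrow>
    (\<exists>a b. a \<le> b \<and> S = {a..b} \<and> F b - F a = 2 * h \<and> minimiser (F a + h))"
proof -
  obtain t0 where t0: "minimiser t0" using minimiser_exists by blast
  then have J: "t0 - h \<in> J" "t0 + h \<in> J" and t0J': "t0 \<in> centres" by (auto simp: minimiser_def centres_def)
  define a0 b0 where "a0 = Q (t0 - h)" and "b0 = Q (t0 + h)"
  have ab0: "a0 \<le> b0" "F b0 - F a0 = 2 * h"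
    using J h by (auto simp: a0_def b0_def intro!: Q_mono)
  \<comment> \<open>The window at a minimiser serves as competitor.\<close>
  have mass0: "silence_mass M X {a0..b0} = 2 * h"
    using measure_Icc[OF ab0(1)] ab0(2) by (simp add: silence_mass_eq)
  have cand: "candidate_interval M X (2 * h) S \<longleftrightarrow> (\<exists>a b. a \<le> b \<and> S = {a..b})"
  proof -
    have "(\<exists>a l. 0 \<le> l \<and> silence_mass M X {a..a + l} = 2 * h)"
      using mass0 ab0 by (intro exI[of _ a0] exI[of _ "b0 - a0"]) simp
    moreover have "(\<exists>a l. 0 \<le> l \<and> S = {a..a + l}) \<longleftrightarrow> (\<exists>a b. a \<le> b \<and> S = {a..b})"
    proof
      assume "\<exists>a b. a \<le> b \<and> S = {a..b}"
      then obtain a b where "a \<le> b" "S = {a..b}" by blast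
      then show "\<exists>a l. 0 \<le> l \<and> S = {a..a + l}" by (intro exI[of _ a] exI[of _ "b - a"]) simp
    next
      assume "\<exists>a l. 0 \<le> l \<and> S = {a..a + l}"
      then obtain a l where "0 \<le> l" "S = {a..a + l}" by blast
      then show "\<exists>a b. a \<le> b \<and> S = {a..b}" by (intro exI[of _ a] exI[of _ "a + l"]) simp
    qed
    ultimately show ?thesis by (auto simp: candidate_interval_def)
  qed
  have opt: "optimal_silence_set M X (2 * h) {a..b} \<longleftrightarrow> minimiser (F a + h)"
    if ab: "a \<le> b" "F b - F a = 2 * h" for a b
  proof
    note centres = window_of_interval(1)[OF ab(2)]
    assume "optimal_silence_set M X (2 * h) {a..b}"
    then have "cond_abs_error M X {a..b} \<le> cond_abs_error M X {a0..b0}"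
      using mass0 by (simp add: optimal_silence_set_def)
    then have "ennreal (W (F a + h) / (2 * h)) \<le> ennreal (W t0 / (2 * h))"
      unfolding cond_abs_error_interval[OF ab(2)] a0_def b0_def cond_abs_error_window[OF t0J'] .
    then have "W (F a + h) \<le> W t0"
      using W_nonneg[OF t0J'] h by (simp add: ennreal_le_iff divide_le_cancel)
    then show "minimiser (F a + h)" using t0 centres by (force simp: minimiser_def)
  next
    assume min: "minimiser (F a + h)"
    have "silence_mass M X {a..b} = 2 * h" using measure_Icc[OF ab(1)] ab(2) by (simp add: silence_mass_eq)
    then show "optimal_silence_set M X (2 * h) {a..b}"
      using cond_abs_error_ge_minimum[OF min]
      by (simp add: optimal_silence_set_def silence_mass_eq cond_abs_error_interval[OF ab(2)])
  qed
  have mass: "silence_mass M X {a..b} = 2 * h \<longleftrightarrow> F b - F a = 2 * h" if "a \<le> b" for a b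
    using measure_Icc[OF that] by (simp add: silence_mass_eq)
  show ?thesis unfolding optimal_interval_def cand using opt mass by blast
qed

lemma unique_of_single_minimiser:
  assumes t0: "minimiser t0" and single: "\<And>t. minimiser t \<Longrightarrow> t = t0"
  shows "unique_optimal_interval M X (2 * h)"
  unfolding unique_optimal_interval_def
proof (intro exI conjI allI impI)
  have J: "t0 - h \<in> J" "t0 + h \<in> J" using t0 by (auto simp: minimiser_def centres_def)
  have F: "F (Q (t0 - h)) = t0 - h" "F (Q (t0 + h)) = t0 + h" using J by simp_all
  have "Q (t0 - h) \<le> Q (t0 + h)" using J h by (intro Q_mono) auto
  then show "optimal_interval M X (2 * h) {Q (t0 - h)..Q (t0 + h)}"
    unfolding optimal_interval_iff using F t0
    by (intro exI[of _ "Q (t0 - h)"] exI[of _ "Q (t0 + h)"]) simp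
  fix T assume "optimal_interval M X (2 * h) T"
  then obtain a b where T: "T = {a..b}" "F b - F a = 2 * h" "minimiser (F a + h)"
    unfolding optimal_interval_iff by blast
  then have "F a + h = t0" using single by blast
  then show "same_silence_set M X T {Q (t0 - h)..Q (t0 + h)}"
    unfolding T(1) using T(2) F by (intro same_silence_set_Icc) linarith+
qed

text \<open>In the case of two minimisers the bounds of the sliding family are determined by the maximal plateau of
  the density. A second family of intervals of length \<open>l'\<close> is excluded as follows: the member in the middle of
  the family has ends whose levels lie strictly between 0 and 1, so these ends are quantiles, and
  \<open>minimal_window_length\<close> gives \<open>l' = l\<close>.\<close>

lemma unique_or_sliding:
  "unique_optimal_interval M X (2 * h) \<or> (\<exists>!(l, lo, hi). sliding_family M X (2 * h) l lo hi)"
proof (cases "\<exists>t0. \<forall>t. minimiser t \<longrightarrow> t = t0")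
  case True
  then show ?thesis using unique_of_single_minimiser minimiser_exists by metis
next
  case False
  obtain s0 where s0: "minimiser s0" using minimiser_exists by blast
  obtain s1 where s1: "minimiser s1" "s1 \<noteq> s0" using False by blast
  define s t where "s = min s0 s1" and "t = max s0 s1"
  have st: "minimiser s" "minimiser t" "s < t" using s0 s1 by (auto simp: s_def t_def min_def max_def)
  obtain c where c0: "0 < c" "\<forall>x. p x \<le> c" and st_less: "Q (s - h) < Q (t + h)"
    and st_plateau0: "\<forall>x. Q (s - h) < x \<and> x < Q (t + h) \<longrightarrow> p x = c"
    and st_mass: "c * (Q (t + h) - Q (s - h)) = t - s + 2 * h"
    using two_minimisers_plateau[OF st] by (elim exE conjE)
  note c = c0(1) c0(2)[rule_format]
  have st_plateau: "p x = c" if "Q (s - h) < x" "x < Q (t + h)" for x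
    using st_plateau0 that by blast
  obtain w where "Q (s - h) < w" "w < Q (t + h)" using dense st_less by blast
  then have w: "p w = c" by (rule st_plateau)
  obtain lo B where E: "\<forall>x. p x = c \<longrightarrow> lo \<le> x \<and> x \<le> B"
    and EB: "\<forall>x. lo < x \<and> x < B \<longrightarrow> p x = c"
    using maximal_plateau[OF c w] by (elim exE conjE)
  define l where "l = 2 * h / c"
  have l: "0 < l" "c * l = 2 * h" using c h by (auto simp: l_def)
  have inside: "lo \<le> x" "y \<le> B" if "x < y" "\<And>z. x < z \<Longrightarrow> z < y \<Longrightarrow> p z = c" for x y
  proof -
    show "lo \<le> x" by (rule dense_ge_bounded[OF \<open>x < y\<close>]) (use that E in blast)
    show "y \<le> B" by (rule dense_le_bounded[OF \<open>x < y\<close>]) (use that E in blast)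
  qed
  have optimal_l: "optimal_interval M X (2 * h) {a..a + l} \<longleftrightarrow> lo \<le> a \<and> a \<le> B - l" for a
  proof
    assume "optimal_interval M X (2 * h) {a..a + l}"
    then obtain a' b' where "a' \<le> b'" "{a..a + l} = {a'..b'}" "F b' - F a' = 2 * h"
      unfolding optimal_interval_iff by blast
    moreover from this have "a' = a" "b' = a + l" using l by (auto simp: Icc_eq_Icc)
    ultimately have "F (a + l) - F a = c * (a + l - a)" using l by simp
    then have "p z = c" if "a < z" "z < a + l" for z
      using plateau_of_full_mass[OF _ c, of a "a + l" z] l that by simp
    then show "lo \<le> a \<and> a \<le> B - l" using inside[of a "a + l"] l by simp
  next
    assume a: "lo \<le> a \<and> a \<le> B - l"
    have plateau: "p z = c" if "a < z" "z < a + l" for z using that a by (intro EB[rule_format]) linarith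
    have len: "c * (a + l - a) = 2 * h" using l by simp
    note window = plateau_window_minimiser[OF c(1) plateau len]
    show "optimal_interval M X (2 * h) {a..a + l}"
      unfolding optimal_interval_iff
      by (intro exI[of _ a] exI[of _ "a + l"]) (use window l in simp)
  qed
  have "lo < B - l"
  proof -
    have "c * l < c * (Q (t + h) - Q (s - h))" using st_mass l st(3) by simp
    then have "l < Q (t + h) - Q (s - h)" using c by simp
    then show ?thesis using inside[OF st_less st_plateau] by linarith
  qed
  then have sliding: "sliding_family M X (2 * h) l lo (B - l)"
    using l optimal_l by (simp add: sliding_family_def)
  have unique: "l' = l \<and> lo' = lo \<and> hi' = B - l"
    if sl: "sliding_family M X (2 * h) l' lo' hi'" for l' lo' hi'
  proof -
    have l': "0 < l'" "lo' < hi'"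
      and opt: "\<And>a. optimal_interval M X (2 * h) {a..a + l'} \<longleftrightarrow> lo' \<le> a \<and> a \<le> hi'"
      using sl by (auto simp: sliding_family_def)
    have mass: "F (a + l') - F a = 2 * h \<and> minimiser (F a + h)" if a: "lo' \<le> a" "a \<le> hi'" for a
    proof -
      have "optimal_interval M X (2 * h) {a..a + l'}" using opt a by simp
      then obtain a' b' where "a' \<le> b'" "{a..a + l'} = {a'..b'}" "F b' - F a' = 2 * h" "minimiser (F a' + h)"
        unfolding optimal_interval_iff by blast
      moreover from this have "a' = a" "b' = a + l'" using l' by (auto simp: Icc_eq_Icc)
      ultimately show ?thesis by simp
    qed
    have F_eq: "x = y" if "F x = F y" "0 < F x" "F x < 1" for x y
    proof -
      have "x \<in> U" "y \<in> U" using that by (simp_all add: U_def)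
      then show ?thesis using F_inj[of x y] U_subset_C that(1) by blast
    qed
    define a where "a = (lo' + hi') / 2"
    have a: "lo' < a" "a < hi'" using l' by (auto simp: a_def)
    have ma: "F (a + l') - F a = 2 * h" "minimiser (F a + h)" using mass[of a] a by auto
    have F_ends: "F (lo' + l') - F lo' = 2 * h" "F (hi' + l') - F hi' = 2 * h"
      using mass[of lo'] mass[of hi'] l' by auto
    \<comment> \<open>Otherwise the right ends at \<open>lo'\<close> and \<open>a\<close> would be different points with the same level in \<open>{0<..<1}\<close>.\<close>
    have Fa: "0 < F a"
    proof (rule ccontr)
      assume "\<not> 0 < F a"
      then have "F a = 0" "F lo' = 0"
        using F_bounds(1)[of a] F_bounds(1)[of lo'] F_mono[of lo' a] a by linarith+
      then have "lo' + l' = a + l'"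
        using ma(1) F_ends(1) h by - (rule F_eq; linarith)
      then show False using a by simp
    qed
    have Fb: "F (a + l') < 1"
    proof (rule ccontr)
      assume "\<not> F (a + l') < 1"
      then have "F (a + l') = 1" "F (hi' + l') = 1"
        using F_bounds(2)[of "a + l'"] F_bounds(2)[of "hi' + l'"] F_mono[of "a + l'" "hi' + l'"] a by linarith+
      then have "a = hi'"
        using ma(1) F_ends(2) h by - (rule F_eq; linarith)
      then show False using a by simp
    qed
    have eqs: "F a + h + h = F (a + l')" "F a + h - h = F a" using ma(1) by linarith+
    have "Q (F (a + l')) = a + l'" "Q (F a) = a"
      using Fa Fb ma(1) h by - (rule Q_eqI[OF refl]; linarith)+
    then have "c * l' = 2 * h"
      using minimal_window_length[OF st ma(2) c(2) w] unfolding eqs by simp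
    then have "c * l' = c * l" using l(2) by simp
    then have "l' = l" using c(1) by simp
    moreover have "(lo' \<le> a \<and> a \<le> hi') = (lo \<le> a \<and> a \<le> B - l)" for a
      using opt[of a] optimal_l[of a] \<open>l' = l\<close> by simp
    then have "{lo'..hi'} = {lo..B - l}" by (auto simp: set_eq_iff)
    then have "lo' = lo \<and> hi' = B - l" using l'(2) by (simp add: Icc_eq_Icc)
    ultimately show ?thesis by simp
  qed
  have "\<exists>!(l, lo, hi). sliding_family M X (2 * h) l lo hi"
  proof (rule ex1I[of _ "(l, lo, B - l)"])
    show "case (l, lo, B - l) of (l, lo, hi) \<Rightarrow> sliding_family M X (2 * h) l lo hi"
      using sliding by simp
  next
    fix x assume "case x of (l, lo, hi) \<Rightarrow> sliding_family M X (2 * h) l lo hi"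
    moreover obtain l' lo' hi' where x: "x = (l', lo', hi')" by (cases x)
    ultimately have "sliding_family M X (2 * h) l' lo' hi'" by simp
    from unique[OF this] show "x = (l, lo, B - l)" unfolding x by simp
  qed
  then show ?thesis ..
qed

end

context log_concave_variable
begin

lemma unique_optimal_of_null: "unique_optimal_interval M X 0"
proof -
  have null: "silence_mass M X {0..0} = 0" by (simp add: silence_mass_eq)
  have err: "cond_abs_error M X {0..0} = 0"
    using cond_abs_error_null[OF prob_M X_measurable _ null] by simp
  have "optimal_interval M X 0 {0..0}"
    unfolding optimal_interval_def
  proof (intro conjI)
    show "candidate_interval M X 0 {0..0}"
      unfolding candidate_interval_def by (rule disjI1, intro exI[of _ 0]) simp
  qed (use null err in \<open>simp_all add: optimal_silence_set_def\<close>)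
  moreover have "same_silence_set M X T {0..0}" if T: "optimal_interval M X 0 T" for T
  proof -
    have Tb: "T \<in> sets borel" and "silence_mass M X T = 0"
      using T by (auto simp: optimal_interval_def optimal_silence_set_def)
    then have "emeasure N T = 0" by (simp add: silence_mass_eq N.emeasure_eq_measure)
    then have "AE x in N. x \<notin> T" using Tb by (intro AE_not_in) auto
    moreover have "AE x in N. x \<notin> {0..0}" by (intro AE_not_in) (auto simp: null_sets_def)
    ultimately have "AE x in N. x \<in> T \<longleftrightarrow> x \<in> {0..0}" by eventually_elim simp
    then show ?thesis using Tb by (simp add: same_silence_set_iff)
  qed
  ultimately show ?thesis unfolding unique_optimal_interval_def by blast
qed

text \<open>If no bounded interval has full mass, the whole line takes its place.\<close>

lemma unique_optimal_of_full: "unique_optimal_interval M X 1"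
proof -
  have same: "same_silence_set M X S T"
    if S: "S \<in> sets borel" "1 \<le> silence_mass M X S" and T: "T \<in> sets borel" "1 \<le> silence_mass M X T" for S T
  proof -
    have "measure N S = 1" "measure N T = 1"
      using S T N.prob_le_1[of S] N.prob_le_1[of T] by (auto simp: silence_mass_eq intro: antisym)
    then have "AE x in N. x \<in> S" "AE x in N. x \<in> T"
      using S T by (simp_all add: N.prob_eq_1)
    then have "AE x in N. x \<in> S \<longleftrightarrow> x \<in> T" by eventually_elim simp
    then show ?thesis using S T by (simp add: same_silence_set_iff)
  qed
  have optimal: "optimal_silence_set M X 1 S" if "S \<in> sets borel" "silence_mass M X S = 1" for S
    unfolding optimal_silence_set_def
    using that same same_silence_set_cong(2) by (metis order_refl)
  obtain S where S: "candidate_interval M X 1 S" "silence_mass M X S = 1" "S \<in> sets borel"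
  proof (cases "\<exists>a l. 0 \<le> l \<and> silence_mass M X {a..a + l} = 1")
    case True
    then obtain a l where "0 \<le> l" "silence_mass M X {a..a + l} = 1" by blast
    then show ?thesis using that[of "{a..a + l}"] by (auto simp: candidate_interval_def)
  next
    case False
    have "silence_mass M X UNIV = 1" using N.prob_space by (simp add: silence_mass_eq)
    moreover have "candidate_interval M X 1 UNIV"
      unfolding candidate_interval_def using False by (auto simp: is_interval_univ)
    ultimately show ?thesis using that[of UNIV] by simp
  qed
  then have "optimal_interval M X 1 S" using optimal by (simp add: optimal_interval_def)
  moreover have "same_silence_set M X T S" if "optimal_interval M X 1 T" for T
    using that S same[of T S] by (simp add: optimal_interval_def optimal_silence_set_def)
  ultimately show ?thesis unfolding unique_optimal_interval_def by blast
qed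

end

theorem theorem2:
  fixes M :: "'a measure" and X :: "'a \<Rightarrow> real" and p :: "real \<Rightarrow> real" and \<eta> :: real
  assumes "prob_space M"
    and "distributed M lborel X (\<lambda>x. ennreal (p x))"
    and "log_concave_density p"
    and "0 \<le> \<eta>" and "\<eta> \<le> 1"
  shows "unique_optimal_interval M X \<eta> \<or>
         (\<exists>!(l, lo, hi). sliding_family M X \<eta> l lo hi)"
proof -
  have nonneg: "\<And>x. 0 \<le> p x" using assms(3) by (simp add: log_concave_density_def)
  have "(\<lambda>x. enn2real (ennreal (p x))) \<in> borel_measurable lborel"
    using distributed_borel_measurable[OF assms(2)] by measurable
  then have p_borel: "p \<in> borel_measurable borel" using nonneg by simp
  have "distr M lborel X = density lborel (\<lambda>x. ennreal (p x))"
    using assms(2) by (rule distributed_distr_eq_density)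
  then have law: "prob_space (density lborel (\<lambda>x. ennreal (p x)))"
    using prob_space.prob_space_distr[OF assms(1) distributed_measurable[OF assms(2)]] by simp
  interpret log_concave_variable p M X
    by (intro log_concave_variable.intro log_concave_law.intro log_concave_variable_axioms.intro
        assms p_borel law)
  consider "\<eta> = 0" | "\<eta> = 1" | "0 < \<eta>" "\<eta> < 1" using assms(4,5) by linarith
  then show ?thesis
  proof cases
    case 1 then show ?thesis using unique_optimal_of_null by simp
  next
    case 2 then show ?thesis using unique_optimal_of_full by simp
  next
    case 3
    interpret silence_window p M X "\<eta> / 2"
      by (intro silence_window.intro log_concave_window.intro log_concave_window_axioms.intro
          log_concave_variable_axioms log_concave_law_axioms) (use 3 in simp_all)
    show ?thesis using unique_or_sliding by simp
  qed
qed

end
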